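(* Let $\mathfrak{C}$ be a class of languages closed under union, inverse gsm mappings and intersection with regular languages. Let $S$ be a completely regular semigroup that is a union of finitely many finitely generated groups, each of which has (unfolded) word problem in $\mathfrak{C}$. Then the (unfolded) word problem of $S$ is in $\mathfrak{C}$.
   Context: A semigroup is completely regular if it can be expressed as a disjoint union of groups (subsemigroups that are groups under the induced operation). For a semigroup $S$ and a finite generating set $A$ of $S$ (as a semigroup), the (unfolded) word problem of $S$ with respect to $A$ is the language $$\mathrm{WP}(S,A) = \{\, u\#v^{\mathrm{rev}} : u,v\in A^+,\ u =_S v \,\}$$ over the alphabet $A\cup\{\#\}$, where $v^{\mathrm{rev}}$ is the reverse of the word $v$, $\#$ is a new symbol not in $A$, and $u=_S v$ means that $u$ and $v$ represent the same element of $S$. The word problem of $S$ is said to be in $\mathfrak{C}$ if $\mathrm{WP}(S,A)\in\mathfrak{C}$ for some finite generating set $A$ of $S$; when $\mathfrak{C}$ is closed under inverse homomorphism (in particular when it is closed under inverse gsm mappings), this implies $\mathrm{WP}(S,B)\in\mathfrak{C}$ for every finite generating set $B$ of $S$. The word problem of a group is its word problem as a semigroup. A class of languages is a collection of languages over finite alphabets. A generalised sequential machine (gsm) is a tuple $M=(Q,\Sigma,\Delta,\delta,q_0,F)$ with finite state set $Q$, finite input and output alphabets $\Sigma,\Delta$, initial state $q_0\in Q$, final states $F\subseteq Q$, and $\delta$ assigning to each pair in $Q\times\Sigma$ a finite subset of $Q\times\Delta^*$ (next state and output word). For $x\in\Sigma^*$, $M(x)\subseteq\Delta^*$ is the set of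 all concatenated outputs of computations of $M$ that start at $q_0$, read $x$, and end in a state of $F$. The inverse gsm mapping associated with $M$ sends a language $L\subseteq\Delta^*$ to $M^{-1}(L)=\{x\in\Sigma^* : M(x)\cap L\neq\emptyset\}$. Closure under union means closure under the union of two languages in $\mathfrak{C}$. *)

theory Defs
  imports "HOL-Algebra.Generated_Groups" "HOL-Library.Infinite_Typeclass"
begin

text \<open>
  A language is a set of words over a fixed infinite universe \<open>'c\<close> of symbols that uses only
  finitely many of them. Up to renaming of symbols, every finite alphabet lives in \<open>'c\<close>.
\<close>

definition language_class :: "'c list set set \<Rightarrow> bool" where
  "language_class C \<longleftrightarrow> (\<forall>L\<in>C. \<exists>\<Sigma>. finite \<Sigma> \<and> L \<subseteq> lists \<Sigma>)"

definition closed_under_union :: "'c list set set \<Rightarrow> bool" where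
  "closed_under_union C \<longleftrightarrow> (\<forall>K\<in>C. \<forall>L\<in>C. K \<union> L \<in> C)"

text \<open>
  Regular languages are those recognised by deterministic finite automata; states are natural
  numbers, which is no restriction as the state set \<open>Q\<close> is finite.
\<close>

definition regular_language :: "'c list set \<Rightarrow> bool" where
  "regular_language R \<longleftrightarrow>
     (\<exists>Q \<Sigma> d (q0::nat) F. finite Q \<and> finite \<Sigma> \<and> q0 \<in> Q \<and> F \<subseteq> Q \<and>
        (\<forall>q\<in>Q. \<forall>a\<in>\<Sigma>. d q a \<in> Q) \<and> R = {w \<in> lists \<Sigma>. foldl d q0 w \<in> F})"

definition closed_under_regular_intersection :: "'c list set set \<Rightarrow> bool" where
  "closed_under_regular_intersection C \<longleftrightarrow> (\<forall>L\<in>C. \<forall>R. regular_language R \<longrightarrow> L \<inter> R \<in> C)"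

record ('q, 'i, 'o) gsm =
  states :: "'q set"
  inputs :: "'i set"
  outputs :: "'o set"
  trans :: "'q \<Rightarrow> 'i \<Rightarrow> ('q \<times> 'o list) set"
  start :: 'q
  final :: "'q set"

definition wf_gsm :: "('q, 'i, 'o) gsm \<Rightarrow> bool" where
  "wf_gsm M \<longleftrightarrow>
     finite (states M) \<and> finite (inputs M) \<and> finite (outputs M) \<and>
     start M \<in> states M \<and> final M \<subseteq> states M \<and>
     (\<forall>q\<in>states M. \<forall>a\<in>inputs M.
        finite (trans M q a) \<and> trans M q a \<subseteq> states M \<times> lists (outputs M))"

text \<open>\<open>gsm_run M q x y r\<close>: some computation from state \<open>q\<close> reads \<open>x\<close>, outputs \<open>y\<close> and ends in
  state \<open>r\<close>.\<close>

inductive gsm_run :: "('q, 'i, 'o) gsm \<Rightarrow> 'q \<Rightarrow> 'i list \<Rightarrow> 'o list \<Rightarrow> 'q \<Rightarrow> bool" for M where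
  Nil: "gsm_run M q [] [] q"
| Cons: "(p, y) \<in> trans M q a \<Longrightarrow> gsm_run M p x z r \<Longrightarrow> gsm_run M q (a # x) (y @ z) r"

definition gsm_map :: "('q, 'i, 'o) gsm \<Rightarrow> 'i list \<Rightarrow> 'o list set" where
  "gsm_map M x = {y. \<exists>q\<in>final M. gsm_run M (start M) x y q}"

definition inverse_gsm :: "('q, 'i, 'o) gsm \<Rightarrow> 'o list set \<Rightarrow> 'i list set" where
  "inverse_gsm M L = {x \<in> lists (inputs M). gsm_map M x \<inter> L \<noteq> {}}"

definition closed_under_inverse_gsm :: "'c list set set \<Rightarrow> bool" where
  "closed_under_inverse_gsm C \<longleftrightarrow>
     (\<forall>(M :: (nat, 'c, 'c) gsm). \<forall>L\<in>C.
        wf_gsm M \<longrightarrow> L \<subseteq> lists (outputs M) \<longrightarrow> inverse_gsm M L \<in> C)"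

text \<open>
  The library's \<open>semigroup\<close> and \<open>semigroup_mult\<close> live on a whole type; an explicit carrier lets
  a semigroup and its subgroups be treated alike.
\<close>

locale semigroup_on =
  fixes S :: "'a set" and f :: "'a \<Rightarrow> 'a \<Rightarrow> 'a"
  assumes nonempty: "S \<noteq> {}"
    and closed: "x \<in> S \<Longrightarrow> y \<in> S \<Longrightarrow> f x y \<in> S"
    and assoc: "x \<in> S \<Longrightarrow> y \<in> S \<Longrightarrow> z \<in> S \<Longrightarrow> f (f x y) z = f x (f y z)"

abbreviation induced_monoid :: "('a \<Rightarrow> 'a \<Rightarrow> 'a) \<Rightarrow> 'a set \<Rightarrow> 'a \<Rightarrow> 'a monoid" where
  "induced_monoid f H e \<equiv> \<lparr>carrier = H, monoid.mult = f, one = e\<rparr>"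

definition subgroup_of_semigroup :: "'a set \<Rightarrow> 'a set \<Rightarrow> ('a \<Rightarrow> 'a \<Rightarrow> 'a) \<Rightarrow> bool" where
  "subgroup_of_semigroup H S f \<longleftrightarrow> H \<subseteq> S \<and> (\<exists>e. group (induced_monoid f H e))"

definition finitely_generated_group :: "'a set \<Rightarrow> ('a \<Rightarrow> 'a \<Rightarrow> 'a) \<Rightarrow> bool" where
  "finitely_generated_group H f \<longleftrightarrow>
     (\<exists>e A. group (induced_monoid f H e) \<and> finite A \<and> A \<subseteq> H \<and>
        generate (induced_monoid f H e) A = H)"

definition completely_regular :: "'a set \<Rightarrow> ('a \<Rightarrow> 'a \<Rightarrow> 'a) \<Rightarrow> bool" where
  "completely_regular S f \<longleftrightarrow>
     (\<exists>P. (\<forall>H\<in>P. subgroup_of_semigroup H S f) \<and> pairwise disjnt P \<and> \<Union>P = S)"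

definition nonempty_words :: "'a set \<Rightarrow> 'a list set" where
  "nonempty_words A = lists A - {[]}"

text \<open>The element represented by a non-empty word; on the empty word the value is junk.\<close>

definition word_value :: "('a \<Rightarrow> 'a \<Rightarrow> 'a) \<Rightarrow> 'a list \<Rightarrow> 'a" where
  "word_value f w = foldl f (hd w) (tl w)"

definition semigroup_generates :: "('a \<Rightarrow> 'a \<Rightarrow> 'a) \<Rightarrow> 'a set \<Rightarrow> 'a set \<Rightarrow> bool" where
  "semigroup_generates f A S \<longleftrightarrow> A \<subseteq> S \<and> word_value f ` nonempty_words A = S"

text \<open>The letter \<open>a\<close> is \<open>Some a\<close>; the new symbol \<open>#\<close> is \<open>None\<close>.\<close>

definition word_problem :: "('a \<Rightarrow> 'a \<Rightarrow> 'a) \<Rightarrow> 'a set \<Rightarrow> 'a option list set" where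
  "word_problem f A =
     {map Some u @ [None] @ rev (map Some v) | u v.
        u \<in> nonempty_words A \<and> v \<in> nonempty_words A \<and> word_value f u = word_value f v}"

text \<open>
  The alphabet of the word problem is renamed injectively into the universe \<open>'c\<close>. For classes
  closed under inverse gsm mappings the renaming chosen does not matter, see
  \<open>renaming_irrelevant\<close> below.
\<close>

definition word_problem_in ::
    "'c list set set \<Rightarrow> 'a set \<Rightarrow> ('a \<Rightarrow> 'a \<Rightarrow> 'a) \<Rightarrow> bool" where
  "word_problem_in C S f \<longleftrightarrow>
     (\<exists>A \<rho>. finite A \<and> semigroup_generates f A S \<and> inj_on \<rho> (insert None (Some ` A)) \<and>
        map \<rho> ` word_problem f A \<in> C)"

lemma renaming_irrelevant:
  fixes C :: "'c list set set" and L :: "'b list set"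
  assumes C: "closed_under_inverse_gsm C"
    and B: "finite B" "L \<subseteq> lists B"
    and inj: "inj_on \<rho> B" "inj_on \<sigma> B"
    and L: "map \<rho> ` L \<in> C"
  shows "map \<sigma> ` L \<in> C"
proof -
  define \<tau> where "\<tau> = inv_into B \<sigma>"
  have tau: "\<tau> (\<sigma> b) = b" if "b \<in> B" for b
    using that inj(2) by (simp add: \<tau>_def)
  define M :: "(nat, 'c, 'c) gsm" where
    "M = \<lparr>states = {0}, inputs = \<sigma> ` B, outputs = \<rho> ` B,
          trans = (\<lambda>q a. {(0, [\<rho> (\<tau> a)])}), start = 0, final = {0}\<rparr>"
  have wf: "wf_gsm M"
    using B(1) tau by (auto simp: wf_gsm_def M_def)
  have out: "map \<rho> ` L \<subseteq> lists (outputs M)"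
    using B(2) by (fastforce simp: M_def)
  have run: "gsm_run M 0 x y 0 \<longleftrightarrow> y = map (\<lambda>a. \<rho> (\<tau> a)) x" for x y
  proof (induction x arbitrary: y)
    case Nil
    show ?case by (auto intro: gsm_run.Nil elim: gsm_run.cases)
  next
    case (Cons a x)
    have "gsm_run M 0 (a # x) y 0 \<longleftrightarrow> (\<exists>z. y = \<rho> (\<tau> a) # z \<and> gsm_run M 0 x z 0)"
    proof
      assume "gsm_run M 0 (a # x) y 0"
      then show "\<exists>z. y = \<rho> (\<tau> a) # z \<and> gsm_run M 0 x z 0"
        by cases (auto simp: M_def)
    next
      assume "\<exists>z. y = \<rho> (\<tau> a) # z \<and> gsm_run M 0 x z 0"
      then obtain z where z: "y = [\<rho> (\<tau> a)] @ z" "gsm_run M 0 x z 0" by auto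
      show "gsm_run M 0 (a # x) y 0"
        unfolding z(1) by (rule gsm_run.Cons[OF _ z(2)]) (simp add: M_def)
    qed
    then show ?case by (simp add: Cons.IH)
  qed
  have "inverse_gsm M (map \<rho> ` L) =
        {x \<in> lists (\<sigma> ` B). map (\<lambda>a. \<rho> (\<tau> a)) x \<in> map \<rho> ` L}"
    using run by (auto simp: inverse_gsm_def gsm_map_def M_def)
  also have "\<dots> = map \<sigma> ` L"
  proof (intro equalityI subsetI)
    fix x assume x: "x \<in> {x \<in> lists (\<sigma> ` B). map (\<lambda>a. \<rho> (\<tau> a)) x \<in> map \<rho> ` L}"
    then obtain w where w: "x = map \<sigma> w" "w \<in> lists B"
      by (auto simp: lists_image)
    obtain l where l: "l \<in> L" "map (\<lambda>a. \<rho> (\<tau> a)) x = map \<rho> l" using x by auto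
    have "map (\<lambda>a. \<rho> (\<tau> a)) x = map \<rho> w" using w tau by auto
    with l have "map \<rho> w = map \<rho> l" by simp
    moreover have "inj_on \<rho> (set w \<union> set l)"
      using inj(1) w(2) l(1) B(2) by (elim inj_on_subset) auto
    ultimately have "w = l" by (simp add: inj_on_map_eq_map)
    with w l show "x \<in> map \<sigma> ` L" by blast
  next
    fix x assume "x \<in> map \<sigma> ` L"
    then obtain l where l: "l \<in> L" "x = map \<sigma> l" by auto
    moreover have "l \<in> lists B" using l(1) B(2) by auto
    moreover have "map (\<lambda>a. \<rho> (\<tau> a)) x = map \<rho> l"
      using \<open>l \<in> lists B\<close> l(2) tau by auto
    moreover have "x \<in> lists (\<sigma> ` B)" using calculation(2,3) by auto
    ultimately show "x \<in> {x \<in> lists (\<sigma> ` B). map (\<lambda>a. \<rho> (\<tau> a)) x \<in> map \<rho> ` L}"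
      by blast
  qed
  finally have "inverse_gsm M (map \<rho> ` L) = map \<sigma> ` L" .
  then show ?thesis
    using C L wf out unfolding closed_under_inverse_gsm_def by metis
qed

end

theory Submission
  imports Defs
begin

text \<open>
  The R-class of an idempotent \<open>e\<close> splits into finitely many orbits under left multiplication by the
  maximal subgroup at \<open>e\<close>, because \<open>S\<close> has only finitely many idempotents. The given groups with
  identity \<open>e\<close> cover that maximal subgroup, so by Neumann's lemma one of them, \<open>G\<close>, has finite
  index, and the R-class also splits into finitely many \<open>G\<close>-orbits. Choosing orbit representatives, a
  machine that reads \<open>u\<close> can keep the representative \<open>t\<close> of \<open>e \<cdot> u\<close> in its state and write a word for
  the element \<open>g\<close> of \<open>G\<close> with \<open>e \<cdot> u = g \<cdot> t\<close>. As \<open>G\<close> acts freely, equality of two elements of the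
  R-class amounts to equality of their representatives and of the two words written. Hence the
  part of the word problem of \<open>S\<close> concerning this R-class is an inverse gsm image of the word problem of
  \<open>G\<close>, and the word problem of \<open>S\<close> is the union of these parts over the finitely many idempotents.
\<close>

section \<open>Generalised sequential machines\<close>

lemma gsm_run_Nil_iff [simp]: "gsm_run M q [] y r \<longleftrightarrow> y = [] \<and> r = q"
  by (auto intro: gsm_run.Nil elim: gsm_run.cases)

lemma gsm_run_Cons_iff:
  "gsm_run M q (a # x) w r \<longleftrightarrow>
     (\<exists>p y z. w = y @ z \<and> (p, y) \<in> trans M q a \<and> gsm_run M p x z r)"
  (is "?l \<longleftrightarrow> ?r")
proof
  assume ?l
  then show ?r by cases blast
qed (blast intro: gsm_run.Cons)

lemma gsm_run_append:
  "gsm_run M q x y p \<Longrightarrow> gsm_run M p x' y' r \<Longrightarrow> gsm_run M q (x @ x') (y @ y') r"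
proof (induction rule: gsm_run.induct)
  case (Cons p y q a x z r)
  then show ?case using gsm_run.Cons by fastforce
qed simp

text \<open>The closure hypothesis speaks only of machines whose states are naturals and whose
  letters lie in \<open>'c\<close>. Transport along injections lets the machines below carry states
  and letters with algebraic meaning.\<close>

lemma inverse_gsm_renamed:
  fixes M :: "('q, 'i, 'o) gsm" and C :: "'c list set set"
  assumes C: "closed_under_inverse_gsm C" and wf: "wf_gsm M"
    and sigma: "inj_on \<sigma> (inputs M)" and rho: "inj_on \<rho> (outputs M)"
    and K: "K \<subseteq> lists (outputs M)" "map \<rho> ` K \<in> C"
  shows "map \<sigma> ` inverse_gsm M K \<in> C"
proof -
  have fin: "finite (states M)" "finite (inputs M)" "finite (outputs M)"
    and st: "start M \<in> states M" "final M \<subseteq> states M"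
    and tr: "\<And>q a. q \<in> states M \<Longrightarrow> a \<in> inputs M \<Longrightarrow>
        finite (trans M q a) \<and> trans M q a \<subseteq> states M \<times> lists (outputs M)"
    using wf unfolding wf_gsm_def by auto
  obtain \<kappa> :: "'q \<Rightarrow> nat" where kappa: "inj_on \<kappa> (states M)"
    using finite_imp_inj_to_nat_seg[OF fin(1)] by blast
  define M' :: "(nat, 'c, 'c) gsm" where
    "M' = \<lparr>states = \<kappa> ` states M, inputs = \<sigma> ` inputs M, outputs = \<rho> ` outputs M,
          trans = (\<lambda>q c. (\<lambda>(p, y). (\<kappa> p, map \<rho> y)) `
            trans M (inv_into (states M) \<kappa> q) (inv_into (inputs M) \<sigma> c)),
          start = \<kappa> (start M), final = \<kappa> ` final M\<rparr>"
  have trans': "trans M' (\<kappa> q) (\<sigma> a) = (\<lambda>(p, y). (\<kappa> p, map \<rho> y)) ` trans M q a"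
    if "q \<in> states M" "a \<in> inputs M" for q a
    using that kappa sigma by (simp add: M'_def)
  have wf': "wf_gsm M'"
    unfolding wf_gsm_def
  proof (intro conjI ballI)
    fix q c assume "q \<in> states M'" "c \<in> inputs M'"
    then obtain p a where pa: "q = \<kappa> p" "p \<in> states M" "c = \<sigma> a" "a \<in> inputs M"
      by (auto simp: M'_def)
    show "finite (trans M' q c)"
      using tr[OF pa(2,4)] trans'[OF pa(2,4)] pa by simp
    show "trans M' q c \<subseteq> states M' \<times> lists (outputs M')"
      using tr[OF pa(2,4)] unfolding pa(1,3) trans'[OF pa(2,4)] by (force simp: M'_def)
  qed (use fin st in \<open>auto simp: M'_def\<close>)
  have run: "gsm_run M' (\<kappa> q) (map \<sigma> x) w s \<longleftrightarrow>
      (\<exists>y r. w = map \<rho> y \<and> s = \<kappa> r \<and> r \<in> states M \<and> y \<in> lists (outputs M) \<and> gsm_run M q x y r)"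
    if "q \<in> states M" "x \<in> lists (inputs M)" for q x w s
    using that
  proof (induction x arbitrary: q w)
    case Nil
    then show ?case by auto
  next
    case (Cons a x)
    then have a: "a \<in> inputs M" and x: "x \<in> lists (inputs M)" by auto
    note t = tr[OF Cons.prems(1) a]
    have "gsm_run M' (\<kappa> q) (map \<sigma> (a # x)) w s \<longleftrightarrow>
        (\<exists>p y z. w = map \<rho> y @ z \<and> (p, y) \<in> trans M q a \<and> gsm_run M' (\<kappa> p) (map \<sigma> x) z s)"
      unfolding list.map gsm_run_Cons_iff trans'[OF Cons.prems(1) a] by fastforce
    also have "\<dots> \<longleftrightarrow> (\<exists>p y z r. w = map \<rho> y @ map \<rho> z \<and> (p, y) \<in> trans M q a \<and>
        s = \<kappa> r \<and> r \<in> states M \<and> z \<in> lists (outputs M) \<and> gsm_run M p x z r)"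
    proof -
      have "gsm_run M' (\<kappa> p) (map \<sigma> x) z s \<longleftrightarrow>
          (\<exists>y r. z = map \<rho> y \<and> s = \<kappa> r \<and> r \<in> states M \<and> y \<in> lists (outputs M) \<and> gsm_run M p x y r)"
        if "(p, y) \<in> trans M q a" for p y z
        using Cons.IH[OF _ x, of p z] that t by auto
      then show ?thesis by blast
    qed
    also have "\<dots> \<longleftrightarrow> (\<exists>y r. w = map \<rho> y \<and> s = \<kappa> r \<and> r \<in> states M \<and>
        y \<in> lists (outputs M) \<and> gsm_run M q (a # x) y r)" (is "?l \<longleftrightarrow> ?r")
    proof
      assume ?l
      then obtain p y z r where *: "w = map \<rho> (y @ z)" "(p, y) \<in> trans M q a" "s = \<kappa> r"
        "r \<in> states M" "z \<in> lists (outputs M)" "gsm_run M p x z r" by auto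
      moreover have "y @ z \<in> lists (outputs M)" using * t by auto
      moreover have "gsm_run M q (a # x) (y @ z) r" using * gsm_run.Cons by fast
      ultimately show ?r by blast
    next
      assume ?r
      then show ?l unfolding gsm_run_Cons_iff by fastforce
    qed
    finally show ?case .
  qed
  have "inverse_gsm M' (map \<rho> ` K) = map \<sigma> ` inverse_gsm M K"
  proof -
    have gsm_map_iff: "gsm_map M' (map \<sigma> x) \<inter> map \<rho> ` K \<noteq> {} \<longleftrightarrow> gsm_map M x \<inter> K \<noteq> {}"
      if x: "x \<in> lists (inputs M)" for x
    proof -
      have "gsm_map M' (map \<sigma> x) = map \<rho> ` (gsm_map M x \<inter> lists (outputs M))"
      proof -
        have "\<kappa> r \<in> \<kappa> ` final M \<longleftrightarrow> r \<in> final M" if "r \<in> states M" for r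
          using inj_on_image_mem_iff[OF kappa that st(2)] .
        note kappa_final = this
        have start: "start M' = \<kappa> (start M)" and final: "final M' = \<kappa> ` final M"
          by (simp_all add: M'_def)
        show ?thesis
        proof (intro equalityI subsetI)
          fix w assume "w \<in> gsm_map M' (map \<sigma> x)"
          then obtain s where s: "s \<in> \<kappa> ` final M" "gsm_run M' (\<kappa> (start M)) (map \<sigma> x) w s"
            unfolding gsm_map_def start final by blast
          then obtain y r where r: "w = map \<rho> y" "s = \<kappa> r" "r \<in> states M" "y \<in> lists (outputs M)"
            "gsm_run M (start M) x y r"
            using run[OF st(1) x] by blast
          then have "r \<in> final M" using s(1) kappa_final by blast
          then show "w \<in> map \<rho> ` (gsm_map M x \<inter> lists (outputs M))"
            using r unfolding gsm_map_def by blast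
        next
          fix w assume "w \<in> map \<rho> ` (gsm_map M x \<inter> lists (outputs M))"
          then obtain y r where r: "w = map \<rho> y" "y \<in> lists (outputs M)" "r \<in> final M"
            "gsm_run M (start M) x y r"
            unfolding gsm_map_def by blast
          then have "gsm_run M' (\<kappa> (start M)) (map \<sigma> x) w (\<kappa> r)"
            using run[OF st(1) x] st(2) by blast
          then show "w \<in> gsm_map M' (map \<sigma> x)"
            using r(3) unfolding gsm_map_def start final by blast
        qed
      qed
      moreover have "map \<rho> ` (gsm_map M x \<inter> lists (outputs M)) \<inter> map \<rho> ` K = map \<rho> ` (gsm_map M x \<inter> K)"
        using inj_on_image_Int[OF inj_on_map_lists[OF rho], of "gsm_map M x \<inter> lists (outputs M)" K] K(1)
        by (simp add: Int_assoc Int_absorb1)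
      ultimately show ?thesis by simp
    qed
    have "inverse_gsm M' (map \<rho> ` K) = {x \<in> map \<sigma> ` lists (inputs M). gsm_map M' x \<inter> map \<rho> ` K \<noteq> {}}"
      unfolding inverse_gsm_def by (simp add: M'_def lists_image)
    also have "\<dots> = map \<sigma> ` inverse_gsm M K"
      unfolding inverse_gsm_def using gsm_map_iff by blast
    finally show ?thesis .
  qed
  moreover have "map \<rho> ` K \<subseteq> lists (outputs M')"
    using K(1) by (fastforce simp: M'_def)
  ultimately show ?thesis
    using C K(2) wf' unfolding closed_under_inverse_gsm_def by metis
qed

text \<open>After the separator the machine is run backwards, so that both halves of the input are
  scanned by the same machine even though the second one is reversed.\<close>

definition palindromic_gsm :: "('q, 'i, 'o) gsm \<Rightarrow> ('q \<times> bool, 'i option, 'o option) gsm" where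
  "palindromic_gsm M =
     \<lparr>states = states M \<times> UNIV, inputs = insert None (Some ` inputs M),
      outputs = insert None (Some ` outputs M),
      trans = (\<lambda>(q, back) c. case c of
          None \<Rightarrow> if \<not> back \<and> q \<in> final M then {((q, True), [None])} else {}
        | Some a \<Rightarrow> if \<not> back then (\<lambda>(p, y). ((p, False), map Some y)) ` trans M q a
            else {((p, True), rev (map Some y)) | p y. p \<in> states M \<and> (q, y) \<in> trans M p a}),
      start = (start M, False), final = {(start M, True)}\<rparr>"

section \<open>Runs and preimages of the palindromic machine\<close>

lemma wf_palindromic_gsm:
  assumes "wf_gsm M"
  shows "wf_gsm (palindromic_gsm M)"
proof -
  let ?N = "palindromic_gsm M"
  have fin: "finite (states M)" "finite (inputs M)" "finite (outputs M)"
    and st: "start M \<in> states M" "final M \<subseteq> states M"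
    and tr: "\<And>q a. q \<in> states M \<Longrightarrow> a \<in> inputs M \<Longrightarrow>
        finite (trans M q a) \<and> trans M q a \<subseteq> states M \<times> lists (outputs M)"
    using assms unfolding wf_gsm_def by auto
  have "finite (trans ?N q c) \<and> trans ?N q c \<subseteq> states ?N \<times> lists (outputs ?N)"
    if q: "q \<in> states ?N" and c: "c \<in> inputs ?N" for q c
  proof (cases c)
    case None
    then show ?thesis using q st by (auto simp: palindromic_gsm_def split: prod.splits)
  next
    case (Some a)
    then have a: "a \<in> inputs M" using c by (auto simp: palindromic_gsm_def)
    obtain r b where r: "q = (r, b)" "r \<in> states M" using q by (auto simp: palindromic_gsm_def)
    have "{((p, True), rev (map Some y)) | p y. p \<in> states M \<and> (r, y) \<in> trans M p a} \<subseteq>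
        (\<lambda>(p, y). ((p, True), rev (map Some y))) ` (states M \<times> snd ` (\<Union>p\<in>states M. trans M p a))"
      by force
    moreover have "finite (\<Union>p\<in>states M. trans M p a)" using fin tr[OF _ a] by blast
    ultimately have "finite {((p, True), rev (map Some y)) | p y. p \<in> states M \<and> (r, y) \<in> trans M p a}"
      by (meson finite_SigmaI finite_imageI finite_subset fin(1))
    moreover have "{((p, True), rev (map Some y)) | p y. p \<in> states M \<and> (r, y) \<in> trans M p a}
        \<subseteq> states ?N \<times> lists (outputs ?N)"
      using tr[OF _ a] by (fastforce simp: palindromic_gsm_def)
    moreover have "(\<lambda>(p, y). ((p, False), map Some y)) ` trans M r a \<subseteq> states ?N \<times> lists (outputs ?N)"
      using tr[OF r(2) a] by (fastforce simp: palindromic_gsm_def)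
    moreover have "trans ?N q c = (if \<not> b then (\<lambda>(p, y). ((p, False), map Some y)) ` trans M r a
        else {((p, True), rev (map Some y)) | p y. p \<in> states M \<and> (r, y) \<in> trans M p a})"
      unfolding Some r(1) palindromic_gsm_def by simp
    ultimately show ?thesis using tr[OF r(2) a] by (cases b) simp_all
  qed
  then show ?thesis
    using fin st unfolding wf_gsm_def by (auto simp: palindromic_gsm_def)
qed

text \<open>The last letter of \<open>v\<close> is read first: each backward transition undoes one
  step of \<open>M\<close>, so the induction on the input extends the run of \<open>M\<close> at its
  end.\<close>

lemma palindromic_run_backD:
  "gsm_run (palindromic_gsm M) (p, True) x w s \<Longrightarrow>
     \<exists>r v y. s = (r, True) \<and> x = rev (map Some v) \<and> w = rev (map Some y) \<and> gsm_run M r v y p"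
proof (induction x arbitrary: p w)
  case Nil
  then show ?case by auto
next
  case (Cons c x)
  then obtain q y0 z where *: "w = y0 @ z" "(q, y0) \<in> trans (palindromic_gsm M) (p, True) c"
    "gsm_run (palindromic_gsm M) q x z s" by (auto simp: gsm_run_Cons_iff)
  then obtain a q' y1 where a: "c = Some a" "q = (q', True)" "y0 = rev (map Some y1)"
    "(p, y1) \<in> trans M q' a"
    by (auto simp: palindromic_gsm_def split: option.splits)
  obtain r v y where IH: "s = (r, True)" "x = rev (map Some v)" "z = rev (map Some y)"
    "gsm_run M r v y q'" using Cons.IH *(3) a(2) by blast
  have "gsm_run M r (v @ [a]) (y @ y1) p"
    using gsm_run_append[OF IH(4), of "[a]" y1 p] a(4) by (auto simp: gsm_run_Cons_iff)
  then show ?case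
    using IH a * by (intro exI[of _ r] exI[of _ "v @ [a]"] exI[of _ "y @ y1"]) auto
qed

text \<open>Backward transitions lead only to members of \<open>states M\<close>; well-formedness
  and the hypotheses on \<open>r\<close> and \<open>v\<close> keep all intermediate states
  there.\<close>

lemma palindromic_run_backI:
  assumes "wf_gsm M"
  shows "gsm_run M r v y p \<Longrightarrow> r \<in> states M \<Longrightarrow> v \<in> lists (inputs M) \<Longrightarrow>
     gsm_run (palindromic_gsm M) (p, True) (rev (map Some v)) (rev (map Some y)) (r, True)"
proof (induction rule: gsm_run.induct)
  case (Nil q)
  then show ?case by simp
next
  case (Cons p' y q a x z r)
  have "p' \<in> states M" using Cons assms unfolding wf_gsm_def by fastforce
  with Cons have "gsm_run (palindromic_gsm M) (r, True) (rev (map Some x)) (rev (map Some z)) (p', True)"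
    by simp
  moreover have "gsm_run (palindromic_gsm M) (p', True) [Some a] (rev (map Some y)) (q, True)"
    using Cons by (auto simp: gsm_run_Cons_iff palindromic_gsm_def)
  ultimately show ?case using gsm_run_append by fastforce
qed

text \<open>Only \<open>None\<close> switches from forward to backward mode, and no transition reads
  it in backward mode, so the separator occurs exactly once. The state at the switch is the common
  end point \<open>p\<close> of both runs of \<open>M\<close>, which forces the halves to agree on a
  state.\<close>

lemma palindromic_runD:
  "gsm_run (palindromic_gsm M) (q, False) x w (r, True) \<Longrightarrow>
     \<exists>u v y z. \<exists>p\<in>final M. x = map Some u @ [None] @ rev (map Some v) \<and>
       w = map Some y @ [None] @ rev (map Some z) \<and> gsm_run M q u y p \<and> gsm_run M r v z p"
proof (induction x arbitrary: q w)
  case Nil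
  then show ?case by auto
next
  case (Cons c x)
  then obtain s y0 z0 where *: "w = y0 @ z0" "(s, y0) \<in> trans (palindromic_gsm M) (q, False) c"
    "gsm_run (palindromic_gsm M) s x z0 (r, True)" by (auto simp: gsm_run_Cons_iff)
  show ?case
  proof (cases c)
    case None
    then have s: "q \<in> final M" "s = (q, True)" "y0 = [None]"
      using * by (auto simp: palindromic_gsm_def split: if_splits)
    then obtain v y where "x = rev (map Some v)" "z0 = rev (map Some y)" "gsm_run M r v y q"
      using palindromic_run_backD[of M q x z0 "(r, True)"] *(3) by auto
    then show ?thesis
      using s None * by (intro exI[of _ "[]"] exI[of _ v] exI[of _ y]) auto
  next
    case (Some a)
    then obtain q' y1 where s: "s = (q', False)" "y0 = map Some y1" "(q', y1) \<in> trans M q a"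
      using * by (auto simp: palindromic_gsm_def)
    then obtain u v y z p where "p \<in> final M" "x = map Some u @ [None] @ rev (map Some v)"
      "z0 = map Some y @ [None] @ rev (map Some z)" "gsm_run M q' u y p" "gsm_run M r v z p"
      using Cons.IH *(3) by blast
    moreover from this have "gsm_run M q (a # u) (y1 @ y) p" using s(3) gsm_run.Cons by fast
    ultimately show ?thesis
      using s Some * by (intro exI[of _ "a # u"] exI[of _ v] exI[of _ "y1 @ y"] exI[of _ z]) auto
  qed
qed

lemma palindromic_run_forwardI:
  "gsm_run M q u y p \<Longrightarrow> gsm_run (palindromic_gsm M) (q, False) (map Some u) (map Some y) (p, False)"
proof (induction rule: gsm_run.induct)
  case (Cons p' y q a x z r)
  then show ?case unfolding list.map map_append
    by (intro gsm_run.Cons[of "(p', False)"]) (force simp: palindromic_gsm_def)+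
qed simp

text \<open>Hides the reversal from all later arguments: a language of separated pairs becomes a
  matter of two forward runs of one machine, compared through their end state and through
  \<open>K\<close>.\<close>

lemma palindromic_preimage_in:
  fixes M :: "('q, 'i, 'o) gsm" and C :: "'c list set set"
  assumes C: "closed_under_inverse_gsm C" and wf: "wf_gsm M"
    and sigma: "inj_on \<sigma> (insert None (Some ` inputs M))"
    and rho: "inj_on \<rho> (insert None (Some ` outputs M))"
    and K: "K \<subseteq> lists (insert None (Some ` outputs M))" "map \<rho> ` K \<in> C"
  shows "map \<sigma> ` {map Some u @ [None] @ rev (map Some v) | u v.
      u \<in> lists (inputs M) \<and> v \<in> lists (inputs M) \<and>
      (\<exists>p\<in>final M. \<exists>y z. gsm_run M (start M) u y p \<and> gsm_run M (start M) v z p \<and>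
        map Some y @ [None] @ rev (map Some z) \<in> K)} \<in> C" (is "map \<sigma> ` ?L \<in> C")
proof -
  let ?N = "palindromic_gsm M"
  have io: "inputs ?N = insert None (Some ` inputs M)" "outputs ?N = insert None (Some ` outputs M)"
    and sf: "start ?N = (start M, False)" "final ?N = {(start M, True)}"
    by (simp_all add: palindromic_gsm_def)
  have "inverse_gsm ?N K = ?L"
  proof (intro equalityI subsetI)
    fix x assume "x \<in> inverse_gsm ?N K"
    then obtain w where w: "x \<in> lists (insert None (Some ` inputs M))" "w \<in> K"
      "gsm_run ?N (start M, False) x w (start M, True)"
      unfolding inverse_gsm_def gsm_map_def io sf by auto
    then obtain u v y z p where "p \<in> final M" "x = map Some u @ [None] @ rev (map Some v)"
      "w = map Some y @ [None] @ rev (map Some z)" "gsm_run M (start M) u y p" "gsm_run M (start M) v z p"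
      using palindromic_runD[OF w(3)] by blast
    moreover from this w(1) have "u \<in> lists (inputs M)" "v \<in> lists (inputs M)" by auto
    ultimately show "x \<in> ?L" using w(2) by blast
  next
    fix x assume "x \<in> ?L"
    then obtain u v p y z where x: "x = map Some u @ [None] @ rev (map Some v)"
      "u \<in> lists (inputs M)" "v \<in> lists (inputs M)" "p \<in> final M"
      "gsm_run M (start M) u y p" "gsm_run M (start M) v z p"
      and inK: "map Some y @ [None] @ rev (map Some z) \<in> K" by blast
    have "start M \<in> states M" using wf unfolding wf_gsm_def by simp
    note backwards = palindromic_run_backI[OF wf x(6) this x(3)]
    have "gsm_run ?N (p, False) [None] [None] (p, True)"
      using x(4) by (auto simp: gsm_run_Cons_iff palindromic_gsm_def)
    from gsm_run_append[OF palindromic_run_forwardI[OF x(5)] gsm_run_append[OF this backwards]]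
    have "gsm_run ?N (start M, False) x (map Some y @ [None] @ rev (map Some z)) (start M, True)"
      unfolding x(1) .
    moreover have "x \<in> lists (inputs ?N)" using x(1-3) unfolding io by auto
    ultimately show "x \<in> inverse_gsm ?N K"
      using inK unfolding inverse_gsm_def gsm_map_def sf by blast
  qed
  then show ?thesis
    using inverse_gsm_renamed[OF C wf_palindromic_gsm[OF wf], of \<sigma> \<rho> K] sigma rho K
    unfolding io by simp
qed

section \<open>Neumann's lemma on coverings by cosets\<close>

lemma (in group) finite_index_if_covered_by_cosets:
  assumes "finite \<K>" "\<And>K. K \<in> \<K> \<Longrightarrow> subgroup K G"
    and "finite D" "D \<subseteq> (\<Union>K\<in>\<K>. rcosets K)" "carrier G \<subseteq> \<Union>D"
  shows "\<exists>K\<in>\<K>. finite (rcosets K)"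
  using assms
proof (induction \<K> arbitrary: D rule: finite_induct)
  case empty
  then show ?case by auto
next
  case (insert K \<K>)
  show ?case
  proof (cases "rcosets K \<subseteq> D")
    case True
    then show ?thesis using insert.prems(2) finite_subset by blast
  next
    case False
    then obtain c where c: "c \<in> carrier G" "K #> c \<notin> D" by (auto simp: RCOSETS_def)
    have K: "subgroup K G" using insert.prems(1) by simp
    define D0 where "D0 = D - rcosets K"
    have "K #> c \<in> rcosets K" using c by (auto simp: RCOSETS_def)
    have cover: "K #> c \<subseteq> \<Union>D0"
    proof
      fix x assume x: "x \<in> K #> c"
      then have "x \<in> carrier G" using c(1) K r_coset_subset_G subgroup.subset by blast
      then obtain X where X: "X \<in> D" "x \<in> X" using insert.prems(4) by blast
      \<comment> \<open>Distinct right cosets of \<open>K\<close> are disjoint, so a member of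
        \<open>D\<close> that meets the missing coset is no coset of \<open>K\<close>.\<close>
      have "X \<notin> rcosets K"
      proof
        assume "X \<in> rcosets K"
        then have "X = K #> c"
          using rcos_disjoint[OF K] \<open>K #> c \<in> rcosets K\<close> x X(2)
          unfolding pairwise_def disjnt_def by blast
        then show False using c(2) X(1) by simp
      qed
      then show "x \<in> \<Union>D0" using X unfolding D0_def by blast
    qed
    txt \<open>Translating the cover of the missing coset covers every coset of \<open>K\<close>.\<close>
    define T where "T X d = X #> (inv c \<otimes> d)" for X d
    have coset: "\<exists>L\<in>\<K>. \<exists>b\<in>carrier G. X = L #> b" if "X \<in> D0" for X
    proof -
      have "X \<in> (\<Union>L\<in>\<K>. rcosets L)" using that insert.prems(3) unfolding D0_def by auto
      then show ?thesis unfolding RCOSETS_def by blast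
    qed
    obtain R where R: "finite R" "R \<subseteq> carrier G" "D \<inter> rcosets K = (\<lambda>d. K #> d) ` R"
    proof -
      have "D \<inter> rcosets K \<subseteq> (\<lambda>d. K #> d) ` carrier G" by (auto simp: RCOSETS_def)
      then show ?thesis using finite_subset_image[of "D \<inter> rcosets K"] insert.prems(2) that
        by (metis finite_Int)
    qed
    define D1 where "D1 = D0 \<union> (\<lambda>(X, d). T X d) ` (D0 \<times> R)"
    have "\<exists>K\<in>\<K>. finite (rcosets K)"
    proof (rule insert.IH)
      show "finite D1" unfolding D1_def D0_def using insert.prems(2) R(1) by blast
      show "D1 \<subseteq> (\<Union>K\<in>\<K>. rcosets K)"
      proof
        fix Y assume "Y \<in> D1"
        then consider "Y \<in> D0" | X d where "X \<in> D0" "d \<in> R" "Y = T X d" unfolding D1_def by auto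
        then have "\<exists>L\<in>\<K>. \<exists>b\<in>carrier G. Y = L #> b"
        proof cases
          case 1
          then show ?thesis using coset by blast
        next
          case 2
          then obtain L b where L: "L \<in> \<K>" "b \<in> carrier G" "X = L #> b" using coset by blast
          have "L \<subseteq> carrier G" using L(1) insert.prems(1) subgroup.subset by blast
          then have "Y = L #> (b \<otimes> (inv c \<otimes> d))"
            unfolding 2(3) T_def L(3) using L(2) c(1) R(2) 2(2) coset_mult_assoc by blast
          then show ?thesis using L c(1) R(2) 2(2) by blast
        qed
        then show "Y \<in> (\<Union>K\<in>\<K>. rcosets K)" unfolding RCOSETS_def by blast
      qed
      show "carrier G \<subseteq> \<Union>D1"
      proof
        fix x assume x: "x \<in> carrier G"
        then obtain X where X: "X \<in> D" "x \<in> X" using insert.prems(4) by blast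
        show "x \<in> \<Union>D1"
        proof (cases "X \<in> rcosets K")
          case False
          then show ?thesis using X unfolding D1_def D0_def by blast
        next
          case True
          then obtain d where d: "d \<in> R" "X = K #> d" using R(3) X(1) by blast
          then obtain k where k: "k \<in> K" "x = k \<otimes> d" using X(2) unfolding r_coset_def by blast
          have kc: "k \<in> carrier G" "d \<in> carrier G" using k d K R(2) subgroup.subset by blast+
          have "k \<otimes> c \<in> K #> c" using k(1) unfolding r_coset_def by blast
          then obtain Y where Y: "Y \<in> D0" "k \<otimes> c \<in> Y" using cover by blast
          \<comment> \<open>Right multiplication by \<open>inv c \<otimes> d\<close> carries the
            missing coset onto the coset of \<open>d\<close>.\<close>
          have "x = (k \<otimes> c) \<otimes> (inv c \<otimes> d)"
            using k(2) kc c(1) by (metis inv_closed m_assoc m_closed r_inv r_one)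
          then have "x \<in> T Y d" unfolding T_def r_coset_def using Y(2) by blast
          then show ?thesis using Y(1) d(1) unfolding D1_def by blast
        qed
      qed
    qed (use insert.prems(1) in blast)
    then show ?thesis by blast
  qed
qed

section \<open>Semigroups covered by groups\<close>

context semigroup_on
begin

section \<open>Maximal subgroups and Green's relation R\<close>

notation f (infixl "\<cdot>" 70)

text \<open>For idempotent \<open>e\<close> this is the group of units of the monoid
  \<open>eSe\<close>, that is, the H-class of \<open>e\<close>.\<close>

definition maximal_subgroup :: "'a \<Rightarrow> 'a set" where
  "maximal_subgroup e = {x \<in> S. e \<cdot> x = x \<and> x \<cdot> e = x \<and>
     (\<exists>y\<in>S. e \<cdot> y = y \<and> y \<cdot> e = y \<and> x \<cdot> y = e \<and> y \<cdot> x = e)}"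

text \<open>Green's relation R, stated with \<open>xS\<close> instead of \<open>xS\<close> with
  \<open>x\<close> adjoined; the two agree in a union of groups, where \<open>x\<close> lies in
  \<open>xS\<close> (\<open>self_in_principal\<close>).\<close>

definition R_class :: "'a \<Rightarrow> 'a set" where
  "R_class x = {y \<in> S. f y ` S = f x ` S}"

lemma group_maximal_subgroup:
  assumes e: "e \<in> S" "e \<cdot> e = e"
  shows "group (induced_monoid f (maximal_subgroup e) e)"
proof (rule groupI; simp)
  fix x y assume x: "x \<in> maximal_subgroup e" and y: "y \<in> maximal_subgroup e"
  then obtain x' y' where xy: "x' \<in> S" "e \<cdot> x' = x'" "x' \<cdot> e = x'" "x \<cdot> x' = e" "x' \<cdot> x = e"
    "y' \<in> S" "e \<cdot> y' = y'" "y' \<cdot> e = y'" "y \<cdot> y' = e" "y' \<cdot> y = e"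
    "x \<in> S" "y \<in> S" "e \<cdot> x = x" "x \<cdot> e = x" "e \<cdot> y = y" "y \<cdot> e = y"
    unfolding maximal_subgroup_def by blast
  have "(x \<cdot> y) \<cdot> (y' \<cdot> x') = x \<cdot> ((y \<cdot> y') \<cdot> x')" using xy(1,6,11,12) by (simp add: assoc closed)
  moreover have "(y' \<cdot> x') \<cdot> (x \<cdot> y) = y' \<cdot> ((x' \<cdot> x) \<cdot> y)"
    using xy(1,6,11,12) by (simp add: assoc closed)
  ultimately have inv: "(x \<cdot> y) \<cdot> (y' \<cdot> x') = e" "(y' \<cdot> x') \<cdot> (x \<cdot> y) = e" using xy by simp_all
  have "e \<cdot> (x \<cdot> y) = x \<cdot> y" "(x \<cdot> y) \<cdot> e = x \<cdot> y" "e \<cdot> (y' \<cdot> x') = y' \<cdot> x'" "(y' \<cdot> x') \<cdot> e = y' \<cdot> x'"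
    using xy e(1) assoc[of e x y] assoc[of x y e] assoc[of e y' x'] assoc[of y' x' e] by simp_all
  with inv show "x \<cdot> y \<in> maximal_subgroup e"
    unfolding maximal_subgroup_def using xy closed by blast
next
  show "e \<in> maximal_subgroup e" using e unfolding maximal_subgroup_def by auto
next
  fix x assume x: "x \<in> maximal_subgroup e"
  then show "e \<cdot> x = x" unfolding maximal_subgroup_def by blast
  show "\<exists>y\<in>maximal_subgroup e. y \<cdot> x = e"
    using x unfolding maximal_subgroup_def by blast
qed (auto simp: maximal_subgroup_def assoc)

text \<open>The product \<open>e \<cdot> e'\<close> equals \<open>e'\<close> because
  \<open>e' = x \<cdot> z\<close> and \<open>e\<close> fixes \<open>x\<close> from the left, and it
  equals \<open>e\<close> because \<open>e = y \<cdot> x\<close> and \<open>e'\<close> fixes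
  \<open>x\<close> from the right.\<close>

lemma maximal_subgroup_unique:
  assumes "e \<in> S" "e' \<in> S" "x \<in> maximal_subgroup e" "x \<in> maximal_subgroup e'"
  shows "e = e'"
proof -
  obtain y z where x: "x \<in> S" "e \<cdot> x = x" "x \<cdot> e' = x" "e' \<cdot> x = x"
    and y: "y \<in> S" "x \<cdot> y = e" "y \<cdot> x = e" and z: "z \<in> S" "x \<cdot> z = e'"
    using assms(3,4) unfolding maximal_subgroup_def by blast
  have "e' \<cdot> e = e" using assoc[of e' x y] assms x y by simp
  moreover have "e \<cdot> e' = e'" using assoc[of e x z] assms x z by simp
  moreover have "e \<cdot> e' = e" using assoc[of y x e'] assms x y by simp
  ultimately show ?thesis by simp
qed

lemma group_identity:
  assumes "H \<subseteq> S" "group (induced_monoid f H e)"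
  shows "e \<in> S" "e \<cdot> e = e" "e \<in> H"
proof -
  interpret H: group "induced_monoid f H e" by fact
  show "e \<in> H" using H.one_closed by simp
  then show "e \<in> S" using assms(1) by blast
  show "e \<cdot> e = e" using H.l_one[of e] \<open>e \<in> H\<close> by simp
qed

lemma group_subset_maximal_subgroup:
  assumes "H \<subseteq> S" "group (induced_monoid f H e)"
  shows "H \<subseteq> maximal_subgroup e"
proof
  interpret H: group "induced_monoid f H e" by fact
  fix x assume x: "x \<in> H"
  have "e \<cdot> x = x" "x \<cdot> e = x" using H.l_one[of x] H.r_one[of x] x by simp_all
  moreover obtain y where y: "y \<in> H" "x \<cdot> y = e" "y \<cdot> x = e"
    using H.inv_closed[of x] H.l_inv[of x] H.r_inv[of x] x by auto
  moreover have "e \<cdot> y = y" "y \<cdot> e = y" using H.l_one[of y] H.r_one[of y] y(1) by simp_all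
  ultimately show "x \<in> maximal_subgroup e"
    unfolding maximal_subgroup_def using x assms(1) by blast
qed

lemma subgroup_maximal_subgroup:
  assumes "H \<subseteq> S" "group (induced_monoid f H e)"
  shows "subgroup H (induced_monoid f (maximal_subgroup e) e)"
proof -
  interpret H: group "induced_monoid f H e" by fact
  interpret M: group "induced_monoid f (maximal_subgroup e) e"
    using group_identity[OF assms] by (intro group_maximal_subgroup)
  show ?thesis
  proof (rule M.subgroupI)
    show "H \<subseteq> carrier (induced_monoid f (maximal_subgroup e) e)"
      using group_subset_maximal_subgroup[OF assms] by simp
    show "H \<noteq> {}" using H.one_closed by auto
  next
    fix x y assume "x \<in> H" "y \<in> H"
    then show "x \<otimes>\<^bsub>induced_monoid f (maximal_subgroup e) e\<^esub> y \<in> H"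
      using H.m_closed[of x y] by simp
  next
    fix x assume x: "x \<in> H"
    then obtain y where y: "y \<in> H" "y \<cdot> x = e"
      using H.inv_closed[of x] H.l_inv[of x] by auto
    then have "inv\<^bsub>induced_monoid f (maximal_subgroup e) e\<^esub> x = y"
      using x group_subset_maximal_subgroup[OF assms] by (intro M.inv_equality) auto
    then show "inv\<^bsub>induced_monoid f (maximal_subgroup e) e\<^esub> x \<in> H" using y by simp
  qed
qed

text \<open>Each of \<open>x\<close> and \<open>e\<close> is a right multiple of the other:
  \<open>x = e \<cdot> x\<close> and \<open>e = x \<cdot> y\<close>. With finitely many idempotents
  this leaves finitely many principal right ideals.\<close>

lemma principal_right_ideal:
  assumes "e \<in> S" "x \<in> maximal_subgroup e"
  shows "f x ` S = f e ` S"
proof (intro equalityI subsetI)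
  obtain y where y: "y \<in> S" "x \<cdot> y = e" and x: "x \<in> S" "e \<cdot> x = x"
    using assms unfolding maximal_subgroup_def by blast
  fix z
  show "z \<in> f e ` S" if z: "z \<in> f x ` S"
  proof -
    obtain s where s: "s \<in> S" "z = x \<cdot> s" using z by blast
    then have "z = e \<cdot> (x \<cdot> s)" using assms x assoc by metis
    then show ?thesis using s x closed by blast
  qed
  show "z \<in> f x ` S" if z: "z \<in> f e ` S"
  proof -
    obtain s where s: "s \<in> S" "z = e \<cdot> s" using z by blast
    then have "z = x \<cdot> (y \<cdot> s)" using x y assoc by metis
    then show ?thesis using s y closed by blast
  qed
qed

section \<open>Values of words and the right ideals they generate\<close>

lemma image_mult_assoc:
  assumes "x \<in> S" "y \<in> S" "X \<subseteq> S"
  shows "f x ` f y ` X = f (x \<cdot> y) ` X"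
  unfolding image_image using assms by (intro image_cong) (auto simp: assoc)

lemma foldl_closed: "t \<in> S \<Longrightarrow> u \<in> lists S \<Longrightarrow> foldl f t u \<in> S"
  by (induction u arbitrary: t) (auto simp: closed)

lemma foldl_mult: "s \<in> S \<Longrightarrow> t \<in> S \<Longrightarrow> u \<in> lists S \<Longrightarrow> foldl f (s \<cdot> t) u = s \<cdot> foldl f t u"
  by (induction u arbitrary: t) (auto simp: closed assoc)

lemma foldl_word_value:
  assumes "s \<in> S" "u \<in> nonempty_words S"
  shows "foldl f s u = s \<cdot> word_value f u"
proof (cases u)
  case (Cons a v)
  then show ?thesis using assms foldl_mult[of s a v] by (auto simp: nonempty_words_def word_value_def)
qed (use assms in \<open>simp add: nonempty_words_def\<close>)

lemma word_value_closed: "u \<in> nonempty_words S \<Longrightarrow> word_value f u \<in> S"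
  by (cases u) (auto simp: nonempty_words_def word_value_def intro: foldl_closed)

lemma foldr_image_subset: "u \<in> lists S \<Longrightarrow> foldr (\<lambda>a. image (f a)) u S \<subseteq> S"
  by (induction u) (auto intro: closed)

text \<open>A machine meets the letters from the left but must know the ideal of what remains. The
  right fold builds that ideal from the end of the word, and the accumulator \<open>s\<close> links
  it to the left fold that evaluates words.\<close>

lemma image_foldr:
  "s \<in> S \<Longrightarrow> u \<in> lists S \<Longrightarrow> f s ` foldr (\<lambda>a. image (f a)) u S = f (foldl f s u) ` S"
proof (induction u arbitrary: s)
  case (Cons a u)
  have "f s ` foldr (\<lambda>a. image (f a)) (a # u) S = f (s \<cdot> a) ` foldr (\<lambda>a. image (f a)) u S"
    using Cons.prems image_mult_assoc[of s a] foldr_image_subset[of u] by simp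
  also have "\<dots> = f (foldl f s (a # u)) ` S"
    using Cons.prems Cons.IH[of "s \<cdot> a"] by (simp add: closed)
  finally show ?case .
qed simp

lemma foldr_image:
  assumes "u \<in> nonempty_words S"
  shows "foldr (\<lambda>a. image (f a)) u S = f (word_value f u) ` S"
  using assms image_foldr by (cases u) (auto simp: nonempty_words_def word_value_def)

end

section \<open>The machine of a subgroup of finite index\<close>

locale union_of_groups = semigroup_on +
  fixes E
  assumes finite_E: "finite E"
    and idempotent: "e \<in> E \<Longrightarrow> e \<in> S" "e \<in> E \<Longrightarrow> e \<cdot> e = e"
    and cover: "x \<in> S \<Longrightarrow> \<exists>e\<in>E. x \<in> maximal_subgroup e"
begin

text \<open>\<open>S\<close> itself is the ideal attached to the empty suffix, where the right fold
  starts.\<close>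

definition right_ideals :: "'a set set" where
  "right_ideals = insert S ((\<lambda>e. f e ` S) ` E)"

lemma principal_in_right_ideals:
  assumes "s \<in> S"
  shows "f s ` S \<in> right_ideals"
proof -
  obtain e where "e \<in> E" "s \<in> maximal_subgroup e" using cover[OF assms] by blast
  then have "f s ` S = f e ` S" using principal_right_ideal idempotent(1) by simp
  then show ?thesis using \<open>e \<in> E\<close> unfolding right_ideals_def by simp
qed

text \<open>For \<open>J = eS\<close> the image is the ideal of \<open>s \<cdot> e\<close>, again
  principal. Hence the ideals a machine has to guess stay within a fixed finite set.\<close>

lemma image_in_right_ideals:
  assumes "s \<in> S" "J \<in> right_ideals"
  shows "f s ` J \<in> right_ideals"
proof (cases "J = S")
  case True
  then show ?thesis using assms principal_in_right_ideals by simp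
next
  case False
  then obtain e where e: "e \<in> E" "J = f e ` S" using assms(2) unfolding right_ideals_def by blast
  then show ?thesis
    using assms(1) idempotent(1) image_mult_assoc[of s e S] principal_in_right_ideals[of "s \<cdot> e"]
    by (simp add: closed)
qed

lemma foldr_in_right_ideals: "u \<in> lists S \<Longrightarrow> foldr (\<lambda>a. image (f a)) u S \<in> right_ideals"
proof (induction u)
  case Nil
  then show ?case by (simp add: right_ideals_def)
next
  case (Cons a u)
  then show ?case by (simp add: image_in_right_ideals)
qed

lemma self_in_principal:
  assumes "s \<in> S"
  shows "s \<in> f s ` S"
proof -
  obtain e where "e \<in> E" "s \<in> maximal_subgroup e" using cover[OF assms] by blast
  then have "e \<in> S" "s = s \<cdot> e" using idempotent(1) unfolding maximal_subgroup_def by auto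
  then show ?thesis by blast
qed

text \<open>By \<open>self_in_principal\<close>, \<open>y\<close> lies in \<open>yS = eS\<close>,
  and an idempotent fixes its own right ideal pointwise.\<close>

lemma R_class_idempotent_mult:
  assumes "e \<in> E" "y \<in> R_class e"
  shows "e \<cdot> y = y"
proof -
  have "y \<in> f e ` S" using assms(2) self_in_principal unfolding R_class_def by blast
  then obtain s where "s \<in> S" "y = e \<cdot> s" by blast
  then show ?thesis using idempotent[OF assms(1)] assoc[of e e s] by simp
qed

text \<open>An instance of Green's lemma: the idempotent \<open>x\<close> of the group around
  \<open>y\<close> is R-related to \<open>e\<close>, so right multiplication by \<open>e\<close>
  moves \<open>y\<close> into the maximal subgroup at \<open>e\<close>, and right multiplication by
  \<open>x\<close> moves it back. The R-class is thus covered by finitely many right translates of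
  that subgroup.\<close>

lemma R_class_mult_idempotent:
  assumes e: "e \<in> E" and y: "y \<in> R_class e"
  obtains x where "x \<in> E" "x \<in> S" "y \<cdot> e \<in> maximal_subgroup e" "y = (y \<cdot> e) \<cdot> x"
proof -
  have yS: "y \<in> S" using y unfolding R_class_def by blast
  obtain x where x: "x \<in> E" "y \<in> maximal_subgroup x" using cover[OF yS] by blast
  have S: "e \<in> S" "x \<in> S" using x e idempotent by auto
  obtain y' where y': "y' \<in> S" "x \<cdot> y' = y'" "y \<cdot> y' = x" "y' \<cdot> y = x" "x \<cdot> y = y" "y \<cdot> x = y"
    using x(2) unfolding maximal_subgroup_def by blast
  have eq: "f x ` S = f e ` S"
    using principal_right_ideal[OF S(2) x(2)] y unfolding R_class_def by simp
  have "x \<in> R_class e" using eq S unfolding R_class_def by simp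
  then have ex: "e \<cdot> x = x" using R_class_idempotent_mult e by blast
  have "e \<in> R_class x" using eq S unfolding R_class_def by simp
  then have xe: "x \<cdot> e = e" using R_class_idempotent_mult x(1) by blast
  have ey: "e \<cdot> y = y" using R_class_idempotent_mult e y by blast
  have ee: "e \<cdot> e = e" using idempotent e by blast
  have ey': "e \<cdot> y' = y'" using assoc[of e x y'] S y' ex by simp
  \<comment> \<open>The inverse of \<open>y \<cdot> e\<close> is \<open>y' \<cdot> e\<close>: the
    inner \<open>e\<close> is absorbed by the factor to its right, which leaves
    \<open>x \<cdot> e = e\<close>.\<close>
  have "(y \<cdot> e) \<cdot> (y' \<cdot> e) = e"
    using S yS y' ey' xe assoc[of y e "y' \<cdot> e"] assoc[of e y' e] assoc[of y y' e] closed by simp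
  moreover have "(y' \<cdot> e) \<cdot> (y \<cdot> e) = e"
    using S yS y' ey xe assoc[of y' e "y \<cdot> e"] assoc[of e y e] assoc[of y' y e] closed by simp
  moreover have "e \<cdot> (y \<cdot> e) = y \<cdot> e" "(y \<cdot> e) \<cdot> e = y \<cdot> e" "e \<cdot> (y' \<cdot> e) = y' \<cdot> e" "(y' \<cdot> e) \<cdot> e = y' \<cdot> e"
    using S yS y'(1) ee ey ey' assoc[of e y e] assoc[of y e e] assoc[of e y' e] assoc[of y' e e] by simp_all
  ultimately have "y \<cdot> e \<in> maximal_subgroup e"
    unfolding maximal_subgroup_def using S yS y'(1) closed by blast
  moreover have "y = (y \<cdot> e) \<cdot> x" using assoc[of y e x] S yS ex y' by simp
  ultimately show ?thesis using that x(1) S(2) by blast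
qed

end

text \<open>\<open>G\<close> has finite index instead of being the whole maximal subgroup, because
  only the given groups come with a word problem in the class.\<close>

locale coset_machine = union_of_groups +
  fixes e G A B
  assumes e: "e \<in> E"
    and subgroup: "subgroup G (induced_monoid f (maximal_subgroup e) e)"
    and finite_index: "finite (rcosets\<^bsub>induced_monoid f (maximal_subgroup e) e\<^esub> G)"
    and A: "finite A" "A \<subseteq> S"
    and B: "finite B" "semigroup_generates f B G"
begin

text \<open>The choice is made from the orbit as a set, so that all elements of an orbit share their
  representative.\<close>

definition orbit_rep :: "'a \<Rightarrow> 'a" where
  "orbit_rep y = (SOME z. z \<in> (\<lambda>g. g \<cdot> y) ` G)"

text \<open>A word for the group element that carries the representative back to \<open>y\<close>,
  as in Schreier rewriting. It is non-empty because word problems compare non-empty words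
  only.\<close>

definition cocycle :: "'a \<Rightarrow> 'a list" where
  "cocycle y = (SOME w. w \<in> nonempty_words B \<and> y = word_value f w \<cdot> orbit_rep y)"

text \<open>In a state \<open>(t, I)\<close> the prefix \<open>u\<close> read so far satisfies \<open>e \<cdot> u = g \<cdot> t\<close>, where \<open>g \<in> G\<close> is the
  element written so far, and \<open>I\<close> is a guess of the right ideal generated by the remaining suffix.
  The second component serves to check that the whole input lies in the R-class of \<open>e\<close>: this
  cannot be seen from \<open>e \<cdot> u\<close> alone.\<close>

definition machine :: "('a \<times> 'a set, 'a, 'a) gsm" where
  "machine =
     \<lparr>states = insert e (orbit_rep ` R_class e) \<times> right_ideals, inputs = A, outputs = B,
      trans = (\<lambda>(t, I) a. {((orbit_rep (t \<cdot> a), J), cocycle (t \<cdot> a)) | J.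
        J \<in> right_ideals \<and> I = f a ` J \<and> t \<cdot> a \<in> R_class e}),
      start = (e, f e ` S), final = insert e (orbit_rep ` R_class e) \<times> {S}\<rparr>"

section \<open>The action of \<open>G\<close> on the R-class of \<open>e\<close>\<close>

lemma e_in_S: "e \<in> S" and ee: "e \<cdot> e = e"
  using idempotent e by auto

lemma G_subset: "G \<subseteq> maximal_subgroup e"
  using subgroup.subset[OF subgroup] by simp

lemma G_in_S: "g \<in> G \<Longrightarrow> g \<in> S"
  using G_subset unfolding maximal_subgroup_def by blast

lemma G_unit: "g \<in> G \<Longrightarrow> e \<cdot> g = g" "g \<in> G \<Longrightarrow> g \<cdot> e = g"
  using G_subset unfolding maximal_subgroup_def by blast+

lemma e_in_G: "e \<in> G"
  using subgroup.one_closed[OF subgroup] by simp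

lemma G_closed: "g \<in> G \<Longrightarrow> h \<in> G \<Longrightarrow> g \<cdot> h \<in> G"
  using subgroup.m_closed[OF subgroup] by simp

lemma G_inverse:
  assumes "g \<in> G"
  obtains h where "h \<in> G" "h \<cdot> g = e" "g \<cdot> h = e"
proof -
  interpret M: group "induced_monoid f (maximal_subgroup e) e"
    by (intro group_maximal_subgroup e_in_S ee)
  have "g \<in> maximal_subgroup e" using assms G_subset by blast
  then show ?thesis
    using that[OF subgroup.m_inv_closed[OF subgroup assms]] M.l_inv[of g] M.r_inv[of g] by simp
qed

lemma R_classD: "y \<in> R_class e \<Longrightarrow> y \<in> S" "y \<in> R_class e \<Longrightarrow> e \<cdot> y = y"
  using R_class_idempotent_mult[OF e] unfolding R_class_def by auto

lemma e_in_R_class: "e \<in> R_class e"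
  unfolding R_class_def using e_in_S by blast

text \<open>R is a left congruence, so \<open>gyS = geS = gS\<close>, and \<open>gS = eS\<close>
  since \<open>g\<close> is a unit of \<open>eSe\<close>.\<close>

lemma mult_in_R_class:
  assumes "g \<in> G" "y \<in> R_class e"
  shows "g \<cdot> y \<in> R_class e"
proof -
  have y: "y \<in> S" "f y ` S = f e ` S" using assms(2) unfolding R_class_def by auto
  have "f (g \<cdot> y) ` S = f g ` f e ` S"
    using image_mult_assoc[of g y S] G_in_S[OF assms(1)] y by simp
  also have "\<dots> = f (g \<cdot> e) ` S" using image_mult_assoc[of g e S] G_in_S[OF assms(1)] e_in_S by simp
  also have "\<dots> = f e ` S"
    using principal_right_ideal[OF e_in_S] assms(1) G_subset G_unit(2) by auto
  finally show ?thesis unfolding R_class_def using closed y(1) G_in_S[OF assms(1)] by blast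
qed

text \<open>With \<open>s\<close> the value of a non-empty \<open>u\<close>, the inclusions
  \<open>eS \<supseteq> yS \<supseteq> ysS = eS\<close> collapse. So the test in each transition
  that the next element is in the R-class rejects no prefix of a word that ends there.\<close>

lemma prefix_in_R_class:
  assumes y: "y \<in> S" "e \<cdot> y = y" and u: "u \<in> lists S" and yu: "foldl f y u \<in> R_class e"
  shows "y \<in> R_class e"
proof (cases "u = []")
  case True
  then show ?thesis using yu by simp
next
  case False
  define s where "s = word_value f u"
  have "u \<in> nonempty_words S" using u False unfolding nonempty_words_def by simp
  then have s: "s \<in> S" "foldl f y u = y \<cdot> s"
    using word_value_closed foldl_word_value y(1) unfolding s_def by auto
  have "f y ` S \<subseteq> f e ` S" using image_mult_assoc[of e y S] y e_in_S closed
    by (metis image_mono image_subset_iff subsetI order_refl)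
  moreover have "f e ` S \<subseteq> f y ` S"
  proof -
    have "f e ` S = f y ` f s ` S" using yu image_mult_assoc[of y s S] y(1) s unfolding R_class_def by simp
    also have "\<dots> \<subseteq> f y ` S" using s(1) closed by (intro image_mono) blast
    finally show ?thesis .
  qed
  ultimately show ?thesis unfolding R_class_def using y(1) by blast
qed

lemma orbit_eq:
  assumes "g \<in> G" "y \<in> S"
  shows "(\<lambda>h. h \<cdot> (g \<cdot> y)) ` G = (\<lambda>h. h \<cdot> y) ` G"
proof (intro equalityI subsetI)
  fix z
  show "z \<in> (\<lambda>h. h \<cdot> y) ` G" if "z \<in> (\<lambda>h. h \<cdot> (g \<cdot> y)) ` G"
  proof -
    from that obtain h where "h \<in> G" "z = (h \<cdot> g) \<cdot> y"
      using assoc[of _ g y] G_in_S assms by auto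
    then show ?thesis using G_closed assms(1) by blast
  qed
  show "z \<in> (\<lambda>h. h \<cdot> (g \<cdot> y)) ` G" if "z \<in> (\<lambda>h. h \<cdot> y) ` G"
  proof -
    from that obtain h where h: "h \<in> G" "z = h \<cdot> y" by blast
    obtain g' where g': "g' \<in> G" "g' \<cdot> g = e" using G_inverse assms(1) by blast
    have "(h \<cdot> g') \<cdot> (g \<cdot> y) = (h \<cdot> (g' \<cdot> g)) \<cdot> y"
      using assoc G_in_S h g' assms closed by metis
    then have "z = (h \<cdot> g') \<cdot> (g \<cdot> y)" using h g' G_unit(2) by simp
    then show ?thesis using G_closed h(1) g'(1) by blast
  qed
qed

lemma orbit_rep_mult: "g \<in> G \<Longrightarrow> y \<in> S \<Longrightarrow> orbit_rep (g \<cdot> y) = orbit_rep y"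
  using orbit_eq unfolding orbit_rep_def by simp

lemma orbit_rep_obtain:
  obtains g where "g \<in> G" "orbit_rep y = g \<cdot> y"
proof -
  have "(\<lambda>g. g \<cdot> y) ` G \<noteq> {}" using e_in_G by blast
  then have "orbit_rep y \<in> (\<lambda>g. g \<cdot> y) ` G" unfolding orbit_rep_def by (simp add: some_in_eq)
  then show ?thesis using that by blast
qed

lemma orbit_rep_in_R_class:
  assumes "y \<in> R_class e"
  shows "orbit_rep y \<in> R_class e"
proof -
  obtain g where "g \<in> G" "orbit_rep y = g \<cdot> y" using orbit_rep_obtain .
  then show ?thesis using mult_in_R_class assms by simp
qed

text \<open>By \<open>R_class_mult_idempotent\<close> every orbit is a right coset of
  \<open>G\<close> multiplied on the right by some \<open>x\<close> in \<open>E\<close>, and there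
  are finitely many of each.\<close>

lemma finite_orbit_reps: "finite (orbit_rep ` R_class e)"
proof -
  let ?H = "induced_monoid f (maximal_subgroup e) e"
  let ?O = "(\<lambda>(D, x). (\<lambda>d. d \<cdot> x) ` D) ` ((rcosets\<^bsub>?H\<^esub> G) \<times> E)"
  have "(\<lambda>g. g \<cdot> y) ` G \<in> ?O" if y: "y \<in> R_class e" for y
  proof -
    obtain x where x: "x \<in> E" "x \<in> S" "y \<cdot> e \<in> maximal_subgroup e" "y = (y \<cdot> e) \<cdot> x"
      using R_class_mult_idempotent[OF e y] .
    have "G #>\<^bsub>?H\<^esub> (y \<cdot> e) = (\<lambda>g. g \<cdot> (y \<cdot> e)) ` G" by (auto simp: r_coset_def)
    moreover have "g \<cdot> y = (g \<cdot> (y \<cdot> e)) \<cdot> x" if "g \<in> G" for g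
      using assoc[of g "y \<cdot> e" x] G_in_S[OF that] x R_classD(1)[OF y] closed e_in_S by simp
    ultimately have "(\<lambda>g. g \<cdot> y) ` G = (\<lambda>d. d \<cdot> x) ` (G #>\<^bsub>?H\<^esub> (y \<cdot> e))"
      by (simp add: image_image)
    moreover have "G #>\<^bsub>?H\<^esub> (y \<cdot> e) \<in> rcosets\<^bsub>?H\<^esub> G" using x(3) by (auto simp: RCOSETS_def)
    ultimately show ?thesis using x(1) by (auto intro!: rev_image_eqI)
  qed
  then have "(\<lambda>y. (\<lambda>g. g \<cdot> y) ` G) ` R_class e \<subseteq> ?O" by (rule image_subsetI)
  moreover have "finite ?O" using finite_index finite_E by (intro finite_imageI finite_cartesian_product)
  ultimately have "finite ((\<lambda>X. SOME z. z \<in> X) ` (\<lambda>y. (\<lambda>g. g \<cdot> y) ` G) ` R_class e)"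
    by (rule finite_imageI[OF finite_subset])
  then show ?thesis unfolding image_image orbit_rep_def .
qed

section \<open>Output words over \<open>B\<close>\<close>

lemma B_in_S: "B \<subseteq> S"
  using B(2) G_in_S unfolding semigroup_generates_def by blast

lemma B_value: "w \<in> nonempty_words B \<Longrightarrow> word_value f w \<in> G"
  using B(2) unfolding semigroup_generates_def by blast

lemma foldl_B:
  assumes "w \<in> nonempty_words B"
  shows "foldl f e w = word_value f w"
proof -
  have "w \<in> nonempty_words S" using assms B_in_S unfolding nonempty_words_def by auto
  then show ?thesis using foldl_word_value[OF e_in_S] B_value[OF assms] G_unit(1) by simp
qed

lemma foldl_B_in_G: "w \<in> lists B \<Longrightarrow> foldl f e w \<in> G"
  using foldl_B B_value e_in_G by (cases "w = []") (auto simp: nonempty_words_def)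

lemma cocycle:
  assumes "y \<in> R_class e"
  shows "cocycle y \<in> nonempty_words B" "y = word_value f (cocycle y) \<cdot> orbit_rep y"
proof -
  obtain g where g: "g \<in> G" "orbit_rep y = g \<cdot> y" using orbit_rep_obtain .
  obtain h where h: "h \<in> G" "h \<cdot> g = e" using G_inverse[OF g(1)] .
  have "y = h \<cdot> orbit_rep y"
    using assoc[of h g y] g h R_classD[OF assms] G_in_S by simp
  moreover obtain w where "w \<in> nonempty_words B" "h = word_value f w"
    using h(1) B(2) unfolding semigroup_generates_def by blast
  ultimately have "\<exists>w. w \<in> nonempty_words B \<and> y = word_value f w \<cdot> orbit_rep y" by blast
  from someI_ex[OF this] show "cocycle y \<in> nonempty_words B" "y = word_value f (cocycle y) \<cdot> orbit_rep y"
    unfolding cocycle_def by blast+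
qed

section \<open>Correctness of the machine\<close>

lemma wf_machine: "wf_gsm machine"
  unfolding wf_gsm_def
proof (intro conjI ballI)
  fix q a assume q: "q \<in> states machine" "a \<in> inputs machine"
  have fin: "finite right_ideals" unfolding right_ideals_def using finite_E by simp
  obtain t I where tI: "q = (t, I)" by (cases q)
  have "trans machine q a \<subseteq> (\<lambda>J. ((orbit_rep (t \<cdot> a), J), cocycle (t \<cdot> a))) ` right_ideals"
    unfolding tI machine_def by auto
  then show "finite (trans machine q a)" using fin finite_surj by blast
  show "trans machine q a \<subseteq> states machine \<times> lists (outputs machine)"
    unfolding tI machine_def using cocycle(1) by (auto simp: nonempty_words_def)
next
  show "finite (states machine)"
    unfolding machine_def right_ideals_def using finite_orbit_reps finite_E by simp
  show "start machine \<in> states machine"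
    unfolding machine_def right_ideals_def using e by simp
  show "final machine \<subseteq> states machine" unfolding machine_def right_ideals_def by auto
qed (simp_all add: machine_def A B)

text \<open>Each transition splits off a factor from \<open>G\<close> on the left, while the
  remaining letters act on the right; the two commute by associativity. Non-emptiness of the output
  is tracked because the word problem of \<open>G\<close> admits only non-empty words.\<close>

lemma machine_run_sound:
  "gsm_run machine (t, I) u w (t', J) \<Longrightarrow> t \<in> R_class e \<Longrightarrow> u \<in> lists A \<Longrightarrow>
     w \<in> lists B \<and> (u \<noteq> [] \<longrightarrow> w \<noteq> []) \<and> t' \<in> R_class e \<and>
     foldl f t u = foldl f e w \<cdot> t' \<and> I = foldr (\<lambda>a. image (f a)) u J"
proof (induction u arbitrary: t I w)
  case Nil
  then show ?case using R_classD(2) by simp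
next
  case (Cons a u)
  then obtain p y z where run: "w = y @ z" "(p, y) \<in> trans machine (t, I) a"
    "gsm_run machine p u z (t', J)" by (auto simp: gsm_run_Cons_iff)
  define s where "s = t \<cdot> a"
  obtain J' where J': "p = (orbit_rep s, J')" "y = cocycle s" "I = f a ` J'" "s \<in> R_class e"
    using run(2) unfolding machine_def s_def by auto
  define g where "g = word_value f y"
  have y: "y \<in> nonempty_words B" "s = g \<cdot> orbit_rep s"
    using cocycle[OF J'(4)] unfolding J'(2) g_def by auto
  have g: "g \<in> G" using B_value y(1) unfolding g_def by blast
  have rep: "orbit_rep s \<in> R_class e" using orbit_rep_in_R_class J'(4) .
  have u: "u \<in> lists A" "u \<in> lists S" using Cons.prems(3) A(2) by auto
  from Cons.IH[OF run(3)[unfolded J'(1)] rep u(1)]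
  have IH: "z \<in> lists B" "t' \<in> R_class e" "foldl f (orbit_rep s) u = foldl f e z \<cdot> t'"
    "J' = foldr (\<lambda>a. image (f a)) u J" by auto
  have z: "z \<in> lists S" "foldl f e z \<in> S" using IH(1) B_in_S foldl_B_in_G G_in_S by auto
  have "foldl f t (a # u) = foldl f (g \<cdot> orbit_rep s) u" using y(2) s_def by simp
  also have "\<dots> = g \<cdot> (foldl f e z \<cdot> t')"
    using foldl_mult[OF G_in_S[OF g] R_classD(1)[OF rep] u(2)] IH(3) by simp
  also have "\<dots> = (g \<cdot> foldl f e z) \<cdot> t'" using assoc G_in_S[OF g] z(2) R_classD(1)[OF IH(2)] by simp
  also have "g \<cdot> foldl f e z = foldl f e w"
    using foldl_mult[OF G_in_S[OF g] e_in_S z(1)] G_unit(2)[OF g] foldl_B[OF y(1)]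
    unfolding run(1) g_def by simp
  finally show ?case
    using IH J'(3) y(1) run(1) unfolding nonempty_words_def by auto
qed

text \<open>The guesses are the true ideals of the remaining suffixes, and
  \<open>prefix_in_R_class\<close> keeps every step defined. The induction is over non-empty words
  because only after reading a letter is the state sure to hold the representative of the current
  element.\<close>

lemma machine_run_complete:
  assumes "u \<noteq> []" "u \<in> lists A" "t \<in> R_class e" "foldl f t u \<in> R_class e"
  shows "\<exists>w. gsm_run machine (t, foldr (\<lambda>a. image (f a)) u S) u w (orbit_rep (foldl f t u), S)"
  using assms
proof (induction u arbitrary: t rule: list_nonempty_induct)
  case (single a)
  then have "((orbit_rep (t \<cdot> a), S), cocycle (t \<cdot> a)) \<in> trans machine (t, f a ` S) a"
    unfolding machine_def right_ideals_def by simp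
  then show ?case by (auto simp: gsm_run_Cons_iff)
next
  case (cons a u)
  define s where "s = t \<cdot> a"
  have t: "t \<in> S" "e \<cdot> t = t" using cons.prems(2) R_classD by auto
  have a: "a \<in> S" and u: "u \<in> lists A" "u \<in> lists S" using cons.prems(1) A(2) by auto
  have s: "s \<in> S" "e \<cdot> s = s" using t a assoc[of e t a] closed e_in_S unfolding s_def by auto
  have sR: "s \<in> R_class e" using prefix_in_R_class[OF s u(2)] cons.prems(3) unfolding s_def by simp
  obtain h where h: "h \<in> G" "orbit_rep s = h \<cdot> s" using orbit_rep_obtain .
  \<comment> \<open>The run continues from the representative, which differs from \<open>s\<close>
    by a left factor \<open>h\<close> in \<open>G\<close>; this affects neither membership in the
    R-class nor the final representative.\<close>
  have fold: "foldl f (orbit_rep s) u = h \<cdot> foldl f s u"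
    using foldl_mult[OF G_in_S[OF h(1)] s(1) u(2)] h(2) by simp
  have "foldl f (orbit_rep s) u \<in> R_class e"
    unfolding fold using mult_in_R_class[OF h(1)] cons.prems(3) unfolding s_def by simp
  then obtain w where w: "gsm_run machine (orbit_rep s, foldr (\<lambda>a. image (f a)) u S) u w
      (orbit_rep (foldl f (orbit_rep s) u), S)"
    using cons.IH[OF u(1) orbit_rep_in_R_class[OF sR]] by blast
  have "orbit_rep (foldl f (orbit_rep s) u) = orbit_rep (foldl f t (a # u))"
    unfolding fold using orbit_rep_mult[OF h(1)] foldl_closed[OF s(1) u(2)] s_def by simp
  moreover have "((orbit_rep s, foldr (\<lambda>a. image (f a)) u S), cocycle s)
      \<in> trans machine (t, foldr (\<lambda>a. image (f a)) (a # u) S) a"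
    using sR foldr_in_right_ideals[OF u(2)] unfolding machine_def s_def by simp
  ultimately show ?case using gsm_run.Cons w by metis
qed

text \<open>A common final state means a common representative, so equal outputs give equal
  products. Conversely, equal elements share their representative, and freeness of the action makes
  the two group elements agree.\<close>

lemma machine_decides_equality:
  assumes u: "u \<in> nonempty_words A" and v: "v \<in> nonempty_words A"
  shows "(\<exists>q\<in>final machine. \<exists>x y. gsm_run machine (start machine) u x q \<and>
      gsm_run machine (start machine) v y q \<and> x \<in> nonempty_words B \<and> y \<in> nonempty_words B \<and>
      word_value f x = word_value f y) \<longleftrightarrow>
    word_value f u = word_value f v \<and> word_value f u \<in> R_class e" (is "?l \<longleftrightarrow> ?r")
proof -
  have S: "w \<in> nonempty_words S" "w \<in> lists A" "w \<noteq> []" if "w \<in> nonempty_words A" for w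
    using that A(2) unfolding nonempty_words_def by auto
  have start: "start machine = (e, f e ` S)"
    and final: "final machine = insert e (orbit_rep ` R_class e) \<times> {S}"
    unfolding machine_def by simp_all
  have left_unit: "foldl f e w = word_value f w"
    if "w \<in> nonempty_words A" "word_value f w \<in> R_class e" for w
    using foldl_word_value[OF e_in_S S(1)[OF that(1)]] R_classD(2)[OF that(2)] by simp
  show ?thesis
  proof
    assume ?l
    then obtain t x y where runs: "gsm_run machine (e, f e ` S) u x (t, S)"
      "gsm_run machine (e, f e ` S) v y (t, S)"
      and xy: "x \<in> nonempty_words B" "y \<in> nonempty_words B" "word_value f x = word_value f y"
      unfolding start final by blast
    have *: "word_value f w = word_value f z \<cdot> t \<and> word_value f w \<in> R_class e"
      if w: "w \<in> nonempty_words A" and z: "z \<in> nonempty_words B"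
        and run: "gsm_run machine (e, f e ` S) w z (t, S)" for w z
    proof -
      note sound = machine_run_sound[OF run e_in_R_class S(2)[OF w]]
      \<comment> \<open>The guess starts at \<open>eS\<close> and ends at \<open>S\<close>, so the
        right fold over the input is \<open>eS\<close>; this certifies that the value lies in the
        R-class.\<close>
      have "f e ` S = f (word_value f w) ` S" using sound foldr_image[OF S(1)[OF w]] by simp
      then have R: "word_value f w \<in> R_class e"
        unfolding R_class_def using word_value_closed[OF S(1)[OF w]] by simp
      then show ?thesis using sound left_unit[OF w R] foldl_B[OF z] by simp
    qed
    show ?r using *[OF u xy(1) runs(1)] *[OF v xy(2) runs(2)] xy(3) by metis
  next
    assume r: ?r
    define s where "s = word_value f u"
    have s: "s \<in> R_class e" "word_value f u = s" "word_value f v = s" using r unfolding s_def by auto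
    have *: "\<exists>x\<in>nonempty_words B. gsm_run machine (e, f e ` S) w x (orbit_rep s, S) \<and>
        s = word_value f x \<cdot> orbit_rep s"
      if w: "w \<in> nonempty_words A" "word_value f w = s" for w
    proof -
      have "foldl f e w = s" using left_unit[OF w(1)] w(2) s(1) by simp
      moreover have I: "foldr (\<lambda>a. image (f a)) w S = f e ` S"
        using foldr_image[OF S(1)[OF w(1)]] w(2) s(1) unfolding R_class_def by simp
      ultimately obtain x where run: "gsm_run machine (e, f e ` S) w x (orbit_rep s, S)"
        using machine_run_complete[OF S(3,2)[OF w(1)] e_in_R_class] s(1) by auto
      note sound = machine_run_sound[OF run e_in_R_class S(2)[OF w(1)]]
      have "x \<in> nonempty_words B" using sound S(3)[OF w(1)] unfolding nonempty_words_def by simp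
      moreover from this have "s = word_value f x \<cdot> orbit_rep s"
        using sound \<open>foldl f e w = s\<close> foldl_B by simp
      ultimately show ?thesis using run by blast
    qed
    obtain x where x: "x \<in> nonempty_words B" "gsm_run machine (e, f e ` S) u x (orbit_rep s, S)"
      "s = word_value f x \<cdot> orbit_rep s" using *[OF u s(2)] by blast
    obtain y where y: "y \<in> nonempty_words B" "gsm_run machine (e, f e ` S) v y (orbit_rep s, S)"
      "s = word_value f y \<cdot> orbit_rep s" using *[OF v s(3)] by blast
    \<comment> \<open>The representative and \<open>e\<close> generate the same right ideal, which
      yields \<open>k\<close> to cancel the representative on the right.\<close>
    have "e \<in> f (orbit_rep s) ` S"
      using orbit_rep_in_R_class[OF s(1)] self_in_principal[OF e_in_S] unfolding R_class_def by simp
    then obtain k where k: "k \<in> S" "orbit_rep s \<cdot> k = e" by blast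
    txt \<open>\<open>G\<close> acts freely on the R-class of \<open>e\<close>.\<close>
    have cancel: "g = s \<cdot> k" if "g \<in> G" "s = g \<cdot> orbit_rep s" for g
      using that k assoc[of g "orbit_rep s" k] G_in_S G_unit(2) R_classD(1)[OF orbit_rep_in_R_class[OF s(1)]]
      by simp
    have "word_value f x = word_value f y"
      using cancel[OF B_value[OF x(1)] x(3)] cancel[OF B_value[OF y(1)] y(3)] by simp
    moreover have "(orbit_rep s, S) \<in> final machine" unfolding final using s(1) by simp
    ultimately show ?l unfolding start using x y by blast
  qed
qed

lemma R_class_word_problem_in:
  fixes C :: "'c list set set"
  assumes C: "closed_under_inverse_gsm C"
    and rho: "inj_on \<rho> (insert None (Some ` B))" "map \<rho> ` word_problem f B \<in> C"
    and sigma: "inj_on \<sigma> (insert None (Some ` A))"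
  shows "map \<sigma> ` {map Some u @ [None] @ rev (map Some v) | u v. u \<in> nonempty_words A \<and>
    v \<in> nonempty_words A \<and> word_value f u = word_value f v \<and> word_value f u \<in> R_class e} \<in> C"
    (is "map \<sigma> ` ?L \<in> C")
proof -
  have io: "inputs machine = A" "outputs machine = B" unfolding machine_def by simp_all
  have sep: "map Some x @ None # rev (map Some y) = map Some x' @ None # rev (map Some y') \<longleftrightarrow> x = x' \<and> y = y'"
    for x y x' y' :: "'a list"
  proof
    assume *: "map Some x @ None # rev (map Some y) = map Some x' @ None # rev (map Some y')"
    have "takeWhile (\<lambda>c. c \<noteq> None) (map Some x @ None # z) = map Some x"
      "dropWhile (\<lambda>c. c \<noteq> None) (map Some x @ None # z) = None # z" for x z
      by (induction x) auto
    then have "map Some x = map Some x'" "rev (map Some y) = rev (map Some y')"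
      using * by (metis, metis list.inject)
    then show "x = x' \<and> y = y'" by (simp add: inj_map_eq_map)
  qed simp
  have in_wp: "map Some x @ [None] @ rev (map Some y) \<in> word_problem f B \<longleftrightarrow>
      x \<in> nonempty_words B \<and> y \<in> nonempty_words B \<and> word_value f x = word_value f y" for x y
    unfolding word_problem_def by (auto simp: sep)
  let ?accepts = "\<lambda>u v. \<exists>p\<in>final machine. \<exists>y z. gsm_run machine (start machine) u y p \<and>
    gsm_run machine (start machine) v z p \<and>
    map Some y @ [None] @ rev (map Some z) \<in> word_problem f B"
  have "u \<in> lists A \<and> v \<in> lists A \<and> ?accepts u v \<longleftrightarrow> u \<in> nonempty_words A \<and>
    v \<in> nonempty_words A \<and> word_value f u = word_value f v \<and> word_value f u \<in> R_class e" for u v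
  \<comment> \<open>An empty half produces the empty output, which the word problem of
    \<open>G\<close> excludes.\<close>
  proof (cases "u = [] \<or> v = []")
    case True
    then show ?thesis unfolding in_wp by (auto simp: nonempty_words_def)
  next
    case False
    then show ?thesis
      unfolding in_wp using machine_decides_equality[of u v] by (auto simp: nonempty_words_def)
  qed
  then have "?L = {map Some u @ [None] @ rev (map Some v) | u v. u \<in> lists A \<and> v \<in> lists A \<and> ?accepts u v}"
    by (intro Collect_cong) metis
  moreover have "word_problem f B \<subseteq> lists (insert None (Some ` B))"
    unfolding word_problem_def nonempty_words_def by auto
  ultimately show ?thesis
    using palindromic_preimage_in[OF C wf_machine, of \<sigma> \<rho> "word_problem f B"] rho sigma
    unfolding io by (simp only: conj_assoc)
qed

end

section \<open>Completely regular semigroups\<close>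

text \<open>The closure hypothesis is binary and \<open>C\<close> is not assumed to contain the
  empty language; hence the index set is non-empty.\<close>

lemma finite_Union_closed:
  assumes "closed_under_union C" "finite I" "I \<noteq> {}" "\<And>i. i \<in> I \<Longrightarrow> L i \<in> C"
  shows "(\<Union>i\<in>I. L i) \<in> C"
  using assms(2-4)
proof (induction I rule: finite_ne_induct)
  case (insert i I)
  then show ?case using assms(1) unfolding closed_under_union_def by simp
qed simp

lemma semigroup_generates_Union:
  assumes "semigroup_on S f" "\<Union>\<G> = S" "\<And>G. G \<in> \<G> \<Longrightarrow> semigroup_generates f (A G) G"
  shows "semigroup_generates f (\<Union>G\<in>\<G>. A G) S"
proof -
  interpret semigroup_on S f by fact
  have sub: "(\<Union>G\<in>\<G>. A G) \<subseteq> S" using assms(2,3) unfolding semigroup_generates_def by blast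
  have "nonempty_words (\<Union>G\<in>\<G>. A G) \<subseteq> nonempty_words S"
    unfolding nonempty_words_def using lists_mono[OF sub] by blast
  then have "word_value f ` nonempty_words (\<Union>G\<in>\<G>. A G) \<subseteq> S"
    using word_value_closed by blast
  moreover have "S \<subseteq> word_value f ` nonempty_words (\<Union>G\<in>\<G>. A G)"
  proof
    fix s assume "s \<in> S"
    then obtain G where G: "G \<in> \<G>" "s \<in> G" using assms(2) by blast
    then have "s \<in> word_value f ` nonempty_words (A G)"
      using assms(3) unfolding semigroup_generates_def by blast
    moreover have "nonempty_words (A G) \<subseteq> nonempty_words (\<Union>G\<in>\<G>. A G)"
      unfolding nonempty_words_def using lists_mono[OF UN_upper[OF G(1), of A]] by blast
    ultimately show "s \<in> word_value f ` nonempty_words (\<Union>G\<in>\<G>. A G)" by blast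
  qed
  ultimately show ?thesis using sub unfolding semigroup_generates_def by blast
qed

section \<open>Word problems of finite unions of groups\<close>

theorem theorem3:
  fixes C :: "'c::infinite list set set"
    and S :: "'a set" and f :: "'a \<Rightarrow> 'a \<Rightarrow> 'a" and \<G> :: "'a set set"
  assumes "language_class C"
    and "closed_under_union C"
    and "closed_under_inverse_gsm C"
    and "closed_under_regular_intersection C"
    and "semigroup_on S f"
    and "completely_regular S f"
    and "finite \<G>" and "\<Union>\<G> = S"
    and "\<And>G. G \<in> \<G> \<Longrightarrow> subgroup_of_semigroup G S f"
    and "\<And>G. G \<in> \<G> \<Longrightarrow> finitely_generated_group G f"
    and "\<And>G. G \<in> \<G> \<Longrightarrow> word_problem_in C G f"
  shows "word_problem_in C S f"
proof -
  interpret semigroup_on S f by fact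
  note C = assms(2,3)
  have sub: "G \<subseteq> S" if "G \<in> \<G>" for G using assms(8) that by blast
  define E where "E = {e. \<exists>G\<in>\<G>. group (induced_monoid f G e)}"
  \<comment> \<open>A set is a group for at most one identity, so \<open>E\<close> has at most one
    element per member of \<open>\<G>\<close> and is finite.\<close>
  have unit: "e = e'" if "G \<in> \<G>" "group (induced_monoid f G e)" "group (induced_monoid f G e')" for G e e'
  proof -
    note id = group_identity[OF sub[OF that(1)] that(2)] group_identity[OF sub[OF that(1)] that(3)]
    have "e \<in> maximal_subgroup e" "e \<in> maximal_subgroup e'"
      using id(3) group_subset_maximal_subgroup[OF sub[OF that(1)]] that(2,3) by blast+
    then show ?thesis using maximal_subgroup_unique id(1,4) by simp
  qed
  have union: "union_of_groups S f E"
  proof (unfold_locales)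
    have "E \<subseteq> (\<lambda>G. SOME e. group (induced_monoid f G e)) ` \<G>"
    proof
      fix e assume "e \<in> E"
      then obtain G where G: "G \<in> \<G>" "group (induced_monoid f G e)" unfolding E_def by blast
      then have "(SOME e. group (induced_monoid f G e)) = e" using unit by (intro some_equality) blast+
      then show "e \<in> (\<lambda>G. SOME e. group (induced_monoid f G e)) ` \<G>" using G(1) by force
    qed
    then show "finite E" using assms(7) finite_surj by blast
  next
    fix e assume "e \<in> E"
    then obtain G where "G \<in> \<G>" "group (induced_monoid f G e)" unfolding E_def by blast
    then show "e \<in> S" "f e e = e" using group_identity[OF sub] by simp_all
  next
    fix x assume "x \<in> S"
    then obtain G where G: "G \<in> \<G>" "x \<in> G" using assms(8) by blast
    then obtain e where e: "group (induced_monoid f G e)"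
      using assms(9)[OF G(1)] unfolding subgroup_of_semigroup_def by blast
    then have "e \<in> E" using G(1) unfolding E_def by blast
    then show "\<exists>e\<in>E. x \<in> maximal_subgroup e"
      using group_subset_maximal_subgroup[OF sub[OF G(1)] e] G(2) by blast
  qed
  then interpret union_of_groups S f E .
  have "\<forall>G\<in>\<G>. \<exists>B \<rho>. finite B \<and> semigroup_generates f B G \<and>
      inj_on \<rho> (insert None (Some ` B)) \<and> map \<rho> ` word_problem f B \<in> C"
    using assms(11) unfolding word_problem_in_def by simp
  from bchoice[OF this] obtain B where gens: "\<forall>G\<in>\<G>. \<exists>\<rho>. finite (B G) \<and> semigroup_generates f (B G) G \<and>
      inj_on \<rho> (insert None (Some ` B G)) \<and> map \<rho> ` word_problem f (B G) \<in> C" ..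
  have finB: "finite (B G)" and genB: "semigroup_generates f (B G) G" if "G \<in> \<G>" for G
    using bspec[OF gens that] by auto
  define A where "A = (\<Union>G\<in>\<G>. B G)"
  have gen: "semigroup_generates f A S"
    unfolding A_def by (rule semigroup_generates_Union[OF assms(5,8) genB])
  then have AS: "A \<subseteq> S" unfolding semigroup_generates_def by blast
  have finA: "finite A" unfolding A_def using assms(7) finB by simp
  then obtain \<sigma> :: "'a option \<Rightarrow> 'c" where sigma: "inj_on \<sigma> (insert None (Some ` A))"
    using arb_inj_on_finite_infinite[of "insert None (Some ` A)"] by blast
  define L where "L e = {map Some u @ [None] @ rev (map Some v) | u v. u \<in> nonempty_words A \<and>
    v \<in> nonempty_words A \<and> word_value f u = word_value f v \<and> word_value f u \<in> R_class e}" for e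
  have "map \<sigma> ` L e \<in> C" if e: "e \<in> E" for e
  proof -
    let ?H = "induced_monoid f (maximal_subgroup e) e"
    interpret H: group ?H using group_maximal_subgroup idempotent[OF e] .
    \<comment> \<open>The given groups with identity \<open>e\<close>; since an element lies in the
      maximal subgroup of only one idempotent, they cover the one at \<open>e\<close>.\<close>
    define \<K> where "\<K> = {G \<in> \<G>. group (induced_monoid f G e)}"
    have K: "subgroup G ?H" if "G \<in> \<K>" for G
      using that subgroup_maximal_subgroup[OF sub] unfolding \<K>_def by blast
    have "carrier ?H \<subseteq> \<Union>\<K>"
    proof
      fix x assume "x \<in> carrier ?H"
      then have x: "x \<in> maximal_subgroup e" by simp
      then obtain G where G: "G \<in> \<G>" "x \<in> G" using assms(8) unfolding maximal_subgroup_def by blast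
      then obtain e' where e': "group (induced_monoid f G e')"
        using assms(9)[OF G(1)] unfolding subgroup_of_semigroup_def by blast
      then have "x \<in> maximal_subgroup e'" "e' \<in> S"
        using G(2) group_subset_maximal_subgroup[OF sub[OF G(1)]] group_identity(1)[OF sub[OF G(1)]] by auto
      then have "e = e'" using maximal_subgroup_unique idempotent(1)[OF e] x by simp
      then show "x \<in> \<Union>\<K>" using G e' unfolding \<K>_def by blast
    qed
    \<comment> \<open>Each subgroup is a coset of itself, so \<open>\<K>\<close> serves both as the
      set of subgroups and as the cover in Neumann's lemma.\<close>
    moreover have "\<K> \<subseteq> (\<Union>K\<in>\<K>. rcosets\<^bsub>?H\<^esub> K)"
      using subgroup.subgroup_in_rcosets[OF K H.is_group] by blast
    moreover have "finite \<K>" unfolding \<K>_def using assms(7) by simp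
    ultimately obtain G where G: "G \<in> \<K>" "finite (rcosets\<^bsub>?H\<^esub> G)"
      using H.finite_index_if_covered_by_cosets[of \<K> \<K>] K by blast
    then have "G \<in> \<G>" unfolding \<K>_def by blast
    then interpret coset_machine S f E e G A "B G"
      using e K[OF G(1)] G(2) finA AS finB genB
      by (intro coset_machine.intro coset_machine_axioms.intro union)
    obtain \<rho> where "inj_on \<rho> (insert None (Some ` B G))" "map \<rho> ` word_problem f (B G) \<in> C"
      using bspec[OF gens \<open>G \<in> \<G>\<close>] by blast
    from R_class_word_problem_in[OF C(2) this sigma] show ?thesis unfolding L_def .
  qed
  moreover have "E \<noteq> {}" using cover nonempty by blast
  ultimately have "(\<Union>e\<in>E. map \<sigma> ` L e) \<in> C"
    using finite_Union_closed[OF C(1) finite_E, of "\<lambda>e. map \<sigma> ` L e"] by simp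
  \<comment> \<open>Pairs of equal words are sorted by an idempotent whose maximal subgroup contains
    the common value; that subgroup lies in the R-class.\<close>
  moreover have "word_problem f A = (\<Union>e\<in>E. L e)"
  proof -
    have "w \<in> (\<Union>e\<in>E. L e)" if w: "w \<in> word_problem f A" for w
    proof -
      obtain u v where uv: "w = map Some u @ [None] @ rev (map Some v)" "u \<in> nonempty_words A"
        "v \<in> nonempty_words A" "word_value f u = word_value f v"
        using w unfolding word_problem_def by blast
      have "word_value f u \<in> S" using uv(2) gen unfolding semigroup_generates_def by blast
      moreover from this obtain e where e: "e \<in> E" "word_value f u \<in> maximal_subgroup e"
        using cover by blast
      ultimately have "word_value f u \<in> R_class e"
        unfolding R_class_def using principal_right_ideal[OF idempotent(1)] by simp
      then have "w \<in> L e" unfolding L_def using uv by blast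
      then show ?thesis using e(1) by blast
    qed
    moreover have "L e \<subseteq> word_problem f A" for e unfolding L_def word_problem_def by blast
    ultimately show ?thesis by blast
  qed
  ultimately have "map \<sigma> ` word_problem f A \<in> C" by (simp only: image_UN)
  then show ?thesis unfolding word_problem_in_def using finA gen sigma by blast
qed

end
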